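(* Let $d\ge2$ be an integer, $q\ge q_\circ(d):=\frac{2(d+1)}{d-1}$ and $s=\frac{d}{2}-\frac{d}{q}$. Then the following two statements are equivalent: (a) there is a constant $C$ such that $\big\| \sup_{t \in (0,1)} |e^{it\sqrt{-\Delta}}f|\big\|_{L^{q}(B^d(0,1))} \le C \|f\|_{H^s(\mathbb{R}^d)}$ for all $f\in H^s(\mathbb R^d)$; (b) there is a constant $C$ such that $\big\| \sup_{t \in \mathbb R} |e^{it\sqrt{-\Delta}}f|\big\|_{L^{q}(\mathbb R^d)} \le C \|f\|_{\dot H^s(\mathbb{R}^d)}$ for all $f\in \dot H^s(\mathbb R^d)$.
   Context: The wave operator is $e^{it\sqrt{-\Delta}}f(x)=\frac1{(2\pi)^d}\int_{\mathbb R^d}e^{i(x\cdot\xi+t|\xi|)}\widehat f(\xi)\,d\xi$, with $\widehat f(\xi)=\int e^{-ix\cdot\xi}f(x)\,dx$. $H^s(\mathbb R^d)$ and $\dot H^s(\mathbb R^d)$ are the inhomogeneous and homogeneous $L^2$ Sobolev spaces, with norms $\|(1-\Delta)^{s/2}f\|_{L^2}$ and $\|(-\Delta)^{s/2}f\|_{L^2}$ respectively; $B^d(0,1)$ is the unit ball of $\mathbb R^d$ centered at the origin. As usual, such maximal estimates may be read as a priori estimates for Schwartz functions $f$ with constants independent of $f$, extended to the whole Sobolev space by density. *)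

theory Defs
  imports "HOL-Analysis.Analysis"
begin

definition partial_deriv :: "'n::finite \<Rightarrow> (real ^ 'n \<Rightarrow> complex) \<Rightarrow> real ^ 'n \<Rightarrow> complex" where
  "partial_deriv j f x = frechet_derivative f (at x) (axis j 1)"

primrec iter_partial_deriv ::
    "'n::finite list \<Rightarrow> (real ^ 'n \<Rightarrow> complex) \<Rightarrow> real ^ 'n \<Rightarrow> complex" where
  "iter_partial_deriv [] f = f"
| "iter_partial_deriv (j # js) f = partial_deriv j (iter_partial_deriv js f)"

(* All iterated partial derivatives being Frechet differentiable everywhere is the same as f being
   C^infinity; the lists js (order retained) play the role of the multi-indices. *)
definition schwartz :: "(real ^ 'n::finite \<Rightarrow> complex) \<Rightarrow> bool" where
  "schwartz f \<longleftrightarrow>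
     (\<forall>js. (\<forall>x. iter_partial_deriv js f differentiable (at x)) \<and>
           (\<forall>N::nat. bounded (range (\<lambda>x. norm x ^ N * norm (iter_partial_deriv js f x)))))"

definition fourier_transform :: "(real ^ 'n::finite \<Rightarrow> complex) \<Rightarrow> real ^ 'n \<Rightarrow> complex" where
  "fourier_transform f \<xi> = (LINT x|lborel. exp (- \<i> * complex_of_real (x \<bullet> \<xi>)) * f x)"

definition wave :: "real \<Rightarrow> (real ^ 'n::finite \<Rightarrow> complex) \<Rightarrow> real ^ 'n \<Rightarrow> complex" where
  "wave t f x = 1 / (2 * complex_of_real pi) ^ CARD('n) *
     (LINT \<xi>|lborel. exp (\<i> * complex_of_real (x \<bullet> \<xi> + t * norm \<xi>)) * fourier_transform f \<xi>)"

(* The operator m(D): multiplication by the symbol m on the Fourier side. *)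
definition fourier_multiplier ::
    "(real ^ 'n::finite \<Rightarrow> real) \<Rightarrow> (real ^ 'n \<Rightarrow> complex) \<Rightarrow> real ^ 'n \<Rightarrow> complex" where
  "fourier_multiplier m f x = 1 / (2 * complex_of_real pi) ^ CARD('n) *
     (LINT \<xi>|lborel. exp (\<i> * complex_of_real (x \<bullet> \<xi>)) * complex_of_real (m \<xi>) * fourier_transform f \<xi>)"

(* (1 - Laplacian)^(s/2) *)
definition bessel_potential :: "real \<Rightarrow> (real ^ 'n::finite \<Rightarrow> complex) \<Rightarrow> real ^ 'n \<Rightarrow> complex" where
  "bessel_potential s = fourier_multiplier (\<lambda>\<xi>. (1 + (norm \<xi>)\<^sup>2) powr (s / 2))"

(* (- Laplacian)^(s/2). As 0 powr s = 0, the symbol is correct at the origin only for s > 0. *)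
definition riesz_derivative :: "real \<Rightarrow> (real ^ 'n::finite \<Rightarrow> complex) \<Rightarrow> real ^ 'n \<Rightarrow> complex" where
  "riesz_derivative s = fourier_multiplier (\<lambda>\<xi>. norm \<xi> powr s)"

(* For exponents p > 0 only, so that the p-th power of infinity is infinity. *)
definition ennreal_powr :: "ennreal \<Rightarrow> real \<Rightarrow> ennreal" where
  "ennreal_powr x p = (if x = \<infinity> then \<infinity> else ennreal (enn2real x powr p))"

(* The L^p norm (0 < p < infinity) of a nonnegative function; it may be infinite. *)
definition Lp_norm :: "real \<Rightarrow> 'a measure \<Rightarrow> ('a \<Rightarrow> ennreal) \<Rightarrow> ennreal" where
  "Lp_norm p M g = ennreal_powr (\<integral>\<^sup>+ x. ennreal_powr (g x) p \<partial>M) (1 / p)"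

definition sobolev_norm :: "real \<Rightarrow> (real ^ 'n::finite \<Rightarrow> complex) \<Rightarrow> ennreal" where
  "sobolev_norm s f = Lp_norm 2 lborel (\<lambda>x. ennreal (norm (bessel_potential s f x)))"

definition hom_sobolev_norm :: "real \<Rightarrow> (real ^ 'n::finite \<Rightarrow> complex) \<Rightarrow> ennreal" where
  "hom_sobolev_norm s f = Lp_norm 2 lborel (\<lambda>x. ennreal (norm (riesz_derivative s f x)))"

definition wave_maximal :: "real set \<Rightarrow> (real ^ 'n::finite \<Rightarrow> complex) \<Rightarrow> real ^ 'n \<Rightarrow> ennreal" where
  "wave_maximal I f x = (SUP t\<in>I. ennreal (norm (wave t f x)))"

definition q_circ :: "nat \<Rightarrow> real" where
  "q_circ d = 2 * (real d + 1) / (real d - 1)"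

end

(*
  The global estimate implies the local one because s > 0, so that |xi|^(2s) <= (1 + |xi|^2)^s.
  Conversely, apply the local estimate to x |-> f (R x). Since s = d/2 - d/q, both sides scale alike, and
  the result bounds the supremum over (0,R) on the ball of radius R by the L^2 norm of
  (R^(-2) + |xi|^2)^(s/2) f^(xi). Letting R tend to infinity gives the homogeneous estimate for t > 0;
  t = 0 follows by continuity and t < 0 by complex conjugation. The Sobolev norms are read on the Fourier
  side by Plancherel's theorem, proved by Gaussian regularization.
*)
theory Submission
  imports Defs "HOL-Probability.Characteristic_Functions"
begin

section \<open>Affine substitutions and products in Lebesgue integrals\<close>

text \<open>The inhomogeneous norm is not invariant under dilations: scaling by \<open>R\<close>
  turns the 1 in its weight into R^(-2), and this term is what separates the two norms. For a fixed
  \<open>R\<close> the bound obtained is therefore weaker than the homogeneous one; what allows a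
  limit is that its constant does not depend on \<open>R\<close>. The factor R^d from the change of
  variables in the ball meets (R^(-d/q))^q from the norm, and for this \<open>s\<close> they cancel
  exactly. The lower bound on \<open>q\<close> gives q > 2 and hence s > 0, which makes the symbol
  |\<xi>|^s continuous at the origin. As it is in general not smooth there, products of symbols and
  transforms may leave the Schwartz class. Plancherel's theorem is therefore proved for continuous,
  bounded, integrable functions, and continuity and rapid decay of the Fourier transform suffice to
  apply it. Joining positive and negative times costs the factor 2^(1/q) in the constant.\<close>

lemma integrable_lborel_affine:
  fixes f :: "'a::euclidean_space \<Rightarrow> 'b::{banach, second_countable_topology}"
  assumes "integrable lborel f" "c \<noteq> 0"
  shows "integrable lborel (\<lambda>x. f (t + c *\<^sub>R x))"
proof -
  have [measurable]: "f \<in> borel_measurable borel"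
    using assms(1) by simp
  have "integrable (density (distr lborel borel (\<lambda>x. t + c *\<^sub>R x)) (\<lambda>_. ennreal (\<bar>c\<bar> ^ DIM('a)))) f"
    using assms lborel_affine[of c t] by (simp add: ennreal_power)
  then have "integrable lborel (\<lambda>x. \<bar>c\<bar> ^ DIM('a) *\<^sub>R f (t + c *\<^sub>R x))"
    by (subst (asm) integrable_density) (auto simp: integrable_distr_eq)
  from integrable_scaleR_right[OF this, of "inverse (\<bar>c\<bar> ^ DIM('a))"] show ?thesis
    using assms(2) by simp
qed

lemma integral_lborel_affine:
  fixes f :: "'a::euclidean_space \<Rightarrow> 'b::{banach, second_countable_topology}"
  assumes [measurable]: "f \<in> borel_measurable borel" and c: "c \<noteq> 0"
  shows "(LINT x|lborel. f x) = \<bar>c\<bar> ^ DIM('a) *\<^sub>R (LINT x|lborel. f (t + c *\<^sub>R x))"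
proof -
  have "(LINT x|lborel. f x)
      = (LINT x|density (distr lborel borel (\<lambda>x. t + c *\<^sub>R x)) (\<lambda>_. ennreal (\<bar>c\<bar> ^ DIM('a))). f x)"
    using c lborel_affine[of c t] by (simp add: ennreal_power)
  also have "\<dots> = \<bar>c\<bar> ^ DIM('a) *\<^sub>R (LINT x|lborel. f (t + c *\<^sub>R x))"
    by (subst integral_density) (auto simp: integral_distr)
  finally show ?thesis .
qed

lemma nn_integral_lborel_affine:
  fixes f :: "'a::euclidean_space \<Rightarrow> ennreal"
  assumes [measurable]: "f \<in> borel_measurable borel" and c: "c \<noteq> 0"
  shows "(\<integral>\<^sup>+x. f x \<partial>lborel) = ennreal (\<bar>c\<bar> ^ DIM('a)) * (\<integral>\<^sup>+x. f (t + c *\<^sub>R x) \<partial>lborel)"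
proof -
  have "(\<integral>\<^sup>+x. f x \<partial>lborel)
      = (\<integral>\<^sup>+x. f x \<partial>density (distr lborel borel (\<lambda>x. t + c *\<^sub>R x)) (\<lambda>_. ennreal (\<bar>c\<bar> ^ DIM('a))))"
    using c lborel_affine[of c t] by (simp add: ennreal_power)
  also have "\<dots> = ennreal (\<bar>c\<bar> ^ DIM('a)) * (\<integral>\<^sup>+x. f (t + c *\<^sub>R x) \<partial>lborel)"
    by (simp add: nn_integral_density nn_integral_distr nn_integral_cmult)
  finally show ?thesis .
qed

text \<open>Fubini over the coordinates: \<open>lborel_eq\<close> presents Lebesgue measure as the
  image of a product of one-dimensional Lebesgue measures, indexed by \<open>Basis\<close>.\<close>

lemma
  fixes f :: "'a::euclidean_space \<Rightarrow> real \<Rightarrow> 'b::{real_normed_field, banach, second_countable_topology}"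
  assumes f: "\<And>b. b \<in> Basis \<Longrightarrow> integrable lborel (f b)"
  shows integrable_lborel_prod: "integrable lborel (\<lambda>x. \<Prod>b\<in>Basis. f b (x \<bullet> b))"
    and integral_lborel_prod:
      "(LINT x|lborel. (\<Prod>b\<in>Basis. f b (x \<bullet> b))) = (\<Prod>b\<in>Basis. (LINT x|lborel. f b x))"
proof -
  interpret product_sigma_finite "\<lambda>_::'a. lborel :: real measure" ..
  have [measurable]: "f b \<in> borel_measurable borel" if "b \<in> Basis" for b
    using f[OF that] by simp
  have *: "(\<Prod>b\<in>Basis. f b ((\<Sum>b\<in>Basis. x b *\<^sub>R b) \<bullet> b)) = (\<Prod>b\<in>Basis. f b (x b))" for x
    by (intro prod.cong) auto
  show "integrable lborel (\<lambda>x. \<Prod>b\<in>Basis. f b (x \<bullet> b))"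
    by (subst lborel_eq, subst integrable_distr_eq) (auto simp: * intro!: product_integrable_prod f)
  show "(LINT x|lborel. (\<Prod>b\<in>Basis. f b (x \<bullet> b))) = (\<Prod>b\<in>Basis. (LINT x|lborel. f b x))"
    by (subst lborel_eq, subst integral_distr) (auto simp: * product_integral_prod f)
qed

section \<open>An integrable majorant of polynomial decay\<close>

lemma integrable_inverse_1_plus_square: "integrable lborel (\<lambda>x::real. inverse (1 + x\<^sup>2))"
proof -
  have "set_integrable lborel (einterval (-\<infinity>) \<infinity>) (\<lambda>x::real. inverse (1 + x\<^sup>2))"
  proof (rule interval_integral_FTC_nonneg(1)[where F = arctan and A = "-(pi/2)" and B = "pi/2"])
    show "((arctan \<circ> real_of_ereal) \<longlongrightarrow> - (pi / 2)) (at_right (- \<infinity>))"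
      using tendsto_arctan_at_bot by (simp add: ereal_tendsto_simps)
    show "((arctan \<circ> real_of_ereal) \<longlongrightarrow> pi / 2) (at_left \<infinity>)"
      using tendsto_arctan_at_top by (simp add: ereal_tendsto_simps)
  qed (auto intro!: DERIV_arctan continuous_intros simp: add_nonneg_eq_0_iff)
  then show ?thesis
    by (simp add: set_integrable_def)
qed

text \<open>Since each coordinate is at most the norm, each of the \<open>DIM('a)\<close> factors of
  the weight dominates one factor 1 + (x \<bullet> b)^2, so a product of one-dimensional integrable
  functions is a majorant.\<close>

lemma integrable_inverse_norm_power:
  "integrable lborel (\<lambda>x::'a::euclidean_space. inverse ((1 + (norm x)\<^sup>2) ^ DIM('a)))"
proof (rule Bochner_Integration.integrable_bound)
  show "integrable lborel (\<lambda>x::'a. \<Prod>b\<in>Basis. inverse (1 + (x \<bullet> b)\<^sup>2))"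
    by (rule integrable_lborel_prod) (rule integrable_inverse_1_plus_square)
  have "inverse ((1 + (norm x)\<^sup>2) ^ DIM('a)) \<le> (\<Prod>b\<in>Basis. inverse (1 + (x \<bullet> b)\<^sup>2))" for x :: 'a
  proof -
    have "(\<Prod>b\<in>(Basis::'a set). inverse (1 + (norm x)\<^sup>2)) \<le> (\<Prod>b\<in>Basis. inverse (1 + (x \<bullet> b)\<^sup>2))"
      by (rule prod_mono, intro conjI le_imp_inverse_le add_left_mono)
         (auto simp: abs_le_square_iff[symmetric] Basis_le_norm add_pos_nonneg)
    then show ?thesis
      by (simp add: power_inverse)
  qed
  then show "AE x::'a in lborel. norm (inverse ((1 + (norm x)\<^sup>2) ^ DIM('a)))
      \<le> norm (\<Prod>b\<in>Basis. inverse (1 + (x \<bullet> b)\<^sup>2))"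
    by (intro AE_I2) (simp add: prod_nonneg)
qed measurable

section \<open>Plancherel's theorem\<close>

text \<open>With positive sign and no normalization, this one integral serves both directions: the
  Fourier transform is its value at \<open>- \<xi>\<close>, and waves and multipliers are its values
  on the Fourier side divided by (2 pi)^d.\<close>

definition fourier_integral :: "('a::euclidean_space \<Rightarrow> complex) \<Rightarrow> 'a \<Rightarrow> complex" where
  "fourier_integral g x = (LINT \<xi>|lborel. iexp (x \<bullet> \<xi>) * g \<xi>)"

lemma integrable_unimodular_mult:
  fixes u g :: "'a \<Rightarrow> complex"
  assumes "integrable M g" "u \<in> borel_measurable M" "\<And>x. norm (u x) = 1"
  shows "integrable M (\<lambda>x. u x * g x)"
  by (rule Bochner_Integration.integrable_bound[OF assms(1)])
     (use assms in \<open>auto simp: norm_mult\<close>)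

lemma integrable_iexp_mult:
  fixes g :: "'a::euclidean_space \<Rightarrow> complex"
  assumes "integrable lborel g"
  shows "integrable lborel (\<lambda>\<xi>. iexp (x \<bullet> \<xi>) * g \<xi>)"
  by (rule integrable_unimodular_mult[OF assms]) auto

lemma norm_fourier_integral_le:
  "norm (fourier_integral g x) \<le> (LINT \<xi>|lborel. norm (g \<xi>))"
  unfolding fourier_integral_def
  by (rule order.trans[OF integral_norm_bound]) (simp add: norm_mult)

lemma isCont_fourier_integral:
  assumes g: "integrable lborel g"
  shows "isCont (fourier_integral g) x"
  unfolding continuous_at_sequentially
proof safe
  fix X assume X: "X \<longlonglongrightarrow> x"
  have [measurable]: "g \<in> borel_measurable borel"
    using g by simp
  show "(fourier_integral g \<circ> X) \<longlonglongrightarrow> fourier_integral g x"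
    unfolding fourier_integral_def comp_def
  proof (rule integral_dominated_convergence[where w = "\<lambda>\<xi>. norm (g \<xi>)"])
    show "AE \<xi> in lborel. (\<lambda>i. iexp (X i \<bullet> \<xi>) * g \<xi>) \<longlonglongrightarrow> iexp (x \<bullet> \<xi>) * g \<xi>"
      by (intro AE_I2 tendsto_intros X)
  qed (use g in \<open>auto simp: norm_mult\<close>)
qed

lemma borel_measurable_fourier_integral [measurable]:
  "integrable lborel g \<Longrightarrow> fourier_integral g \<in> borel_measurable borel"
  by (intro borel_measurable_continuous_onI continuous_at_imp_continuous_on ballI isCont_fourier_integral)

lemma fourier_integral_multiplication:
  fixes F g :: "'a::euclidean_space \<Rightarrow> complex"
  assumes F: "integrable lborel F" and g: "integrable lborel g"
  shows "(LINT x|lborel. F x * fourier_integral g x) = (LINT \<xi>|lborel. g \<xi> * fourier_integral F \<xi>)"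
proof -
  have [measurable]: "g \<in> borel_measurable borel" "F \<in> borel_measurable borel"
    using F g by simp_all
  \<comment> \<open>The kernel is unimodular, so integrating the norm over \<xi> leaves
    \<open>norm (F x)\<close> times a constant, which is integrable in \<open>x\<close>.\<close>
  have int: "integrable (lborel \<Otimes>\<^sub>M lborel) (\<lambda>(x, \<xi>). F x * (iexp (x \<bullet> \<xi>) * g \<xi>))"
  proof (rule lborel_pair.Fubini_integrable)
    show "integrable lborel (\<lambda>x. LINT y|lborel. norm (case (x, y) of (x, \<xi>) \<Rightarrow> F x * (iexp (x \<bullet> \<xi>) * g \<xi>)))"
      using F by (simp add: norm_mult)
    show "AE x in lborel. integrable lborel (\<lambda>y. case (x, y) of (x, \<xi>) \<Rightarrow> F x * (iexp (x \<bullet> \<xi>) * g \<xi>))"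
      using integrable_iexp_mult[OF g] by simp
  qed measurable
  have "(LINT x|lborel. F x * fourier_integral g x)
      = (LINT x|lborel. LINT \<xi>|lborel. F x * (iexp (x \<bullet> \<xi>) * g \<xi>))"
    using integrable_iexp_mult[OF g] by (simp add: fourier_integral_def)
  also have "\<dots> = (LINT \<xi>|lborel. LINT x|lborel. F x * (iexp (x \<bullet> \<xi>) * g \<xi>))"
    using lborel_pair.Fubini_integral[OF int] by simp
  also have "\<dots> = (LINT \<xi>|lborel. LINT x|lborel. g \<xi> * (iexp (\<xi> \<bullet> x) * F x))"
    by (simp add: inner_commute mult_ac)
  also have "\<dots> = (LINT \<xi>|lborel. g \<xi> * fourier_integral F \<xi>)"
    using integrable_iexp_mult[OF F] by (simp add: fourier_integral_def)
  finally show ?thesis .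
qed

section \<open>Gaussians and their Fourier transforms\<close>

definition gaussian :: "'a::euclidean_space \<Rightarrow> real" where
  "gaussian x = exp (- (norm x)\<^sup>2 / 2)"

lemma gaussian_bounds: "0 < gaussian x" "gaussian x \<le> 1"
  by (auto simp: gaussian_def)

lemma continuous_on_gaussian [continuous_intros]:
  "continuous_on S f \<Longrightarrow> continuous_on S (\<lambda>x. gaussian (f x))"
  unfolding gaussian_def by (intro continuous_intros) auto

lemma borel_measurable_gaussian [measurable]: "gaussian \<in> borel_measurable borel"
  by (intro borel_measurable_continuous_onI continuous_intros)

text \<open>The factors on the right are Gaussians on the real line: \<open>gaussian\<close> is
  polymorphic so that the space and its coordinates share one constant.\<close>

lemma gaussian_eq_prod: "gaussian x = (\<Prod>b\<in>Basis. gaussian (x \<bullet> b))"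
  unfolding gaussian_def exp_sum[OF finite_Basis, symmetric] norm_Pair real_norm_def power2_abs
  by (subst power2_norm_eq_inner, subst euclidean_inner)
     (simp add: power2_eq_square sum_negf sum_divide_distrib)

lemma integrable_gaussian_real: "integrable lborel (gaussian :: real \<Rightarrow> real)"
  using integrable_mult_right[OF integrable_normal_density[of 1 0], of "sqrt (2 * pi)"]
  by (simp add: normal_density_def gaussian_def[abs_def])

text \<open>This is the characteristic function of the standard normal distribution, with the
  normalizing factor of the density moved to the other side.\<close>

lemma fourier_integral_gaussian_real:
  "(LINT x|lborel. iexp (t * x) * complex_of_real (gaussian x)) = sqrt (2 * pi) * gaussian (t :: real)"
proof -
  have "char std_normal_distribution t = (LINT x|lborel. std_normal_density x *\<^sub>R iexp (t * x))"
    unfolding char_def by (subst integral_density) (auto simp: normal_density_nonneg)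
  also have "\<dots> = (LINT x|lborel. complex_of_real (1 / sqrt (2 * pi)) * (iexp (t * x) * complex_of_real (gaussian x)))"
    by (intro Bochner_Integration.integral_cong)
       (auto simp: normal_density_def gaussian_def scaleR_conv_of_real)
  finally show ?thesis
    by (simp add: char_std_normal_distribution gaussian_def field_simps)
qed

lemma integrable_gaussian: "integrable lborel (gaussian :: 'a::euclidean_space \<Rightarrow> real)"
  by (subst gaussian_eq_prod[abs_def]) (intro integrable_lborel_prod integrable_gaussian_real)

lemma fourier_integral_gaussian:
  "fourier_integral (\<lambda>x. complex_of_real (gaussian x)) (\<xi>::'a::euclidean_space)
    = complex_of_real (sqrt (2 * pi) ^ DIM('a) * gaussian \<xi>)"
proof -
  have "iexp (\<xi> \<bullet> x) * complex_of_real (gaussian x)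
      = (\<Prod>b\<in>Basis. iexp ((\<xi> \<bullet> b) * (x \<bullet> b)) * complex_of_real (gaussian (x \<bullet> b)))" for x
    by (subst gaussian_eq_prod, subst euclidean_inner)
       (simp add: prod.distrib sum_distrib_left exp_sum)
  then have "fourier_integral (\<lambda>x. complex_of_real (gaussian x)) \<xi>
      = (LINT x|lborel. (\<Prod>b\<in>Basis. iexp ((\<xi> \<bullet> b) * (x \<bullet> b)) * complex_of_real (gaussian (x \<bullet> b))))"
    by (simp add: fourier_integral_def)
  also have "\<dots> = (\<Prod>b\<in>Basis. (LINT x|lborel. iexp ((\<xi> \<bullet> b) * x) * complex_of_real (gaussian x)))"
    using integrable_gaussian_real
    by (intro integral_lborel_prod integrable_unimodular_mult) auto
  also have "\<dots> = (\<Prod>b\<in>Basis. complex_of_real (sqrt (2 * pi) * gaussian (\<xi> \<bullet> b)))"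
    by (simp only: fourier_integral_gaussian_real)
  also have "\<dots> = complex_of_real (sqrt (2 * pi) ^ DIM('a) * gaussian \<xi>)"
    by (subst gaussian_eq_prod[of \<xi>]) (simp add: prod.distrib)
  finally show ?thesis .
qed

lemma borel_measurable_cnj [measurable (raw)]:
  "f \<in> borel_measurable M \<Longrightarrow> (\<lambda>x. cnj (f x)) \<in> borel_measurable M"
  by (rule borel_measurable_continuous_on[of cnj]) (intro continuous_intros)

lemma fourier_integral_dilated_gaussian:
  fixes \<xi> :: "'a::euclidean_space"
  assumes "\<delta> > 0"
  shows "fourier_integral (\<lambda>x. complex_of_real (gaussian (\<delta> *\<^sub>R x))) \<xi>
    = complex_of_real (sqrt (2 * pi) ^ DIM('a) * gaussian (\<xi> /\<^sub>R \<delta>) / \<delta> ^ DIM('a))"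
proof -
  have "complex_of_real (sqrt (2 * pi) ^ DIM('a) * gaussian (\<xi> /\<^sub>R \<delta>))
      = (LINT y|lborel. iexp ((\<xi> /\<^sub>R \<delta>) \<bullet> y) * complex_of_real (gaussian y))"
    using fourier_integral_gaussian[of "\<xi> /\<^sub>R \<delta>"] by (simp add: fourier_integral_def)
  also have "\<dots> = \<delta> ^ DIM('a) *\<^sub>R fourier_integral (\<lambda>x. complex_of_real (gaussian (\<delta> *\<^sub>R x))) \<xi>"
  proof -
    have "(\<xi> /\<^sub>R \<delta>) \<bullet> (0 + \<delta> *\<^sub>R x) = \<xi> \<bullet> x" for x
      using assms by simp
    then show ?thesis
      using assms unfolding fourier_integral_def
      by (subst integral_lborel_affine[where c = \<delta> and t = 0]) (simp_all only: add_0 abs_of_pos, measurable)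
  qed
  finally show ?thesis
    using assms by (simp add: scaleR_conv_of_real field_simps)
qed

text \<open>The transform of \<open>g\<close> is known to be bounded but not to be integrable; the
  Gaussian factor makes the product \<open>?F\<close> integrable. Writing the squared modulus as the
  transform times its conjugate, the multiplication formula moves the transform from
  \<open>g\<close> to \<open>?F\<close>. A second use of the formula identifies the transform of
  \<open>?F\<close> as a conjugated Gaussian average of \<open>g\<close>.\<close>

lemma fourier_integral_gaussian_regularization:
  fixes g :: "'a::euclidean_space \<Rightarrow> complex"
  assumes g: "integrable lborel g" and \<delta>: "\<delta> > 0"
  shows "(LINT x|lborel. complex_of_real (gaussian (\<delta> *\<^sub>R x) * (norm (fourier_integral g x))\<^sup>2))
    = (LINT \<xi>|lborel. g \<xi> * cnj (sqrt (2 * pi) ^ DIM('a) *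
         (LINT u|lborel. complex_of_real (gaussian u) * g (\<xi> + \<delta> *\<^sub>R u))))"
proof -
  let ?G = "fourier_integral g" and ?c = "complex_of_real (sqrt (2 * pi) ^ DIM('a))"
  let ?F = "\<lambda>x. complex_of_real (gaussian (\<delta> *\<^sub>R x)) * cnj (?G x)"
  define M where "M = (LINT \<xi>|lborel. norm (g \<xi>))"
  have M: "norm (?G x) \<le> M" for x
    unfolding M_def by (rule norm_fourier_integral_le)
  have [measurable]: "g \<in> borel_measurable borel" "?G \<in> borel_measurable borel"
    using g by simp_all
  have int\<gamma>: "integrable lborel (\<lambda>x::'a. gaussian (\<delta> *\<^sub>R x))"
    using integrable_lborel_affine[OF integrable_gaussian, of \<delta> "0::'a"] \<delta> by simp
  have intF: "integrable lborel ?F"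
  proof (rule Bochner_Integration.integrable_bound)
    show "integrable lborel (\<lambda>x::'a. M * gaussian (\<delta> *\<^sub>R x))"
      using int\<gamma> by simp
    show "AE x in lborel. norm (?F x) \<le> norm (M * gaussian (\<delta> *\<^sub>R x))"
      using M by (intro AE_I2) (auto simp: norm_mult abs_mult mult.commute[of _ "gaussian _"]
        gaussian_bounds less_imp_le intro!: mult_left_mono order_trans[OF _ abs_ge_self])
  qed measurable
  have F_hat: "fourier_integral ?F \<xi> = cnj (?c * (LINT u|lborel. complex_of_real (gaussian u) * g (\<xi> + \<delta> *\<^sub>R u)))"
    for \<xi>
  proof -
    \<comment> \<open>Up to conjugation, \<open>?H\<close> absorbs the exponential at \<xi>.
      Modulation becomes translation under the transform, so the transform of \<open>?H\<close> is a
      Gaussian of width \<delta> centred at \<xi>.\<close>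
    let ?H = "\<lambda>x. iexp (- (\<xi> \<bullet> x)) * complex_of_real (gaussian (\<delta> *\<^sub>R x))"
    have H_hat: "fourier_integral ?H \<eta>
        = complex_of_real (sqrt (2 * pi) ^ DIM('a) * gaussian ((\<eta> - \<xi>) /\<^sub>R \<delta>) / \<delta> ^ DIM('a))" for \<eta>
    proof -
      have "fourier_integral ?H \<eta> = fourier_integral (\<lambda>x. complex_of_real (gaussian (\<delta> *\<^sub>R x))) (\<eta> - \<xi>)"
        unfolding fourier_integral_def
        by (intro Bochner_Integration.integral_cong)
           (auto simp: inner_diff_left exp_diff exp_minus right_diff_distrib divide_inverse)
      then show ?thesis
        by (simp add: fourier_integral_dilated_gaussian \<delta>)
    qed
    have "fourier_integral ?F \<xi> = (LINT x|lborel. cnj (?H x * ?G x))"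
      by (simp add: fourier_integral_def exp_cnj mult_ac)
    also have "\<dots> = cnj (LINT x|lborel. ?H x * ?G x)"
      by (rule Bochner_Integration.integral_cnj)
    also have "(LINT x|lborel. ?H x * ?G x) = (LINT \<eta>|lborel. g \<eta> * fourier_integral ?H \<eta>)"
      using int\<gamma> by (intro fourier_integral_multiplication g integrable_unimodular_mult) auto
    also have "\<dots> = (LINT \<eta>|lborel. g \<eta> * complex_of_real (sqrt (2 * pi) ^ DIM('a) * gaussian ((\<eta> - \<xi>) /\<^sub>R \<delta>) / \<delta> ^ DIM('a)))"
      by (simp only: H_hat)
    \<comment> \<open>Substituting \<eta> = \<xi> + \<delta> u recentres and rescales the Gaussian;
      the Jacobian then cancels the power of \<delta> in its height.\<close>
    also have "\<dots> = \<delta> ^ DIM('a) *\<^sub>R (LINT u|lborel. g (\<xi> + \<delta> *\<^sub>R u) * complex_of_real (sqrt (2 * pi) ^ DIM('a) * gaussian u / \<delta> ^ DIM('a)))"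
      using \<delta> by (subst integral_lborel_affine[where c = \<delta> and t = \<xi>]) auto
    also have "\<dots> = \<delta> ^ DIM('a) *\<^sub>R (LINT u|lborel. (?c / \<delta> ^ DIM('a)) * (complex_of_real (gaussian u) * g (\<xi> + \<delta> *\<^sub>R u)))"
      by (simp add: mult_ac)
    also have "\<dots> = ?c * (LINT u|lborel. complex_of_real (gaussian u) * g (\<xi> + \<delta> *\<^sub>R u))"
      using \<delta> by (simp add: scaleR_conv_of_real)
    finally show ?thesis .
  qed
  have "(LINT x|lborel. complex_of_real (gaussian (\<delta> *\<^sub>R x) * (norm (?G x))\<^sup>2)) = (LINT x|lborel. ?F x * ?G x)"
    by (simp add: complex_norm_square mult_ac del: of_real_power)
  also have "\<dots> = (LINT \<xi>|lborel. g \<xi> * fourier_integral ?F \<xi>)"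
    by (rule fourier_integral_multiplication[OF intF g])
  finally show ?thesis
    by (simp add: F_hat)
qed

text \<open>In the regularized identity \<delta> tends to 0. One side converges by dominated
  convergence, for which continuity and the bound \<open>B\<close> are assumed; the other converges
  by monotone convergence, so square integrability of the transform is a result and not a premise.
  The constant is the square of \<open>sqrt (2 * pi) ^ DIM('a)\<close>: one factor comes from the
  transform of the Gaussian, the other from its mass.\<close>

lemma plancherel:
  fixes g :: "'a::euclidean_space \<Rightarrow> complex"
  assumes g: "integrable lborel g" and cont: "\<And>x. isCont g x" and B: "\<And>x. norm (g x) \<le> B"
  shows "(\<integral>\<^sup>+x. ennreal ((norm (fourier_integral g x))\<^sup>2) \<partial>lborel)
    = ennreal ((2 * pi) ^ DIM('a) * (LINT \<xi>|lborel. (norm (g \<xi>))\<^sup>2))"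
proof -
  let ?G = "fourier_integral g" and ?c = "sqrt (2 * pi) ^ DIM('a)"
  define \<delta> where "\<delta> n = 1 / real (Suc n)" for n
  have \<delta>: "\<delta> n > 0" "\<delta> \<longlonglongrightarrow> 0" "decseq \<delta>" for n
    using LIMSEQ_inverse_real_of_nat
    by (auto simp: \<delta>_def[abs_def] decseq_def field_simps inverse_eq_divide)
  \<comment> \<open>\<open>K n\<close> is, up to a factor, the average of \<open>g\<close> against a
    Gaussian of width \<open>\<delta> n\<close>, an approximate identity. \<open>L n\<close> is the
    damped integral of the squared transform, and the regularized identity pairs \<open>g\<close>
    with \<open>K n\<close> to give \<open>L n\<close>.\<close>
  define K where "K n \<xi> = ?c * (LINT u|lborel. complex_of_real (gaussian u) * g (\<xi> + \<delta> n *\<^sub>R u))" for n \<xi>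
  define L where "L n = (LINT x|lborel. gaussian (\<delta> n *\<^sub>R x) * (norm (?G x))\<^sup>2)" for n
  have [measurable]: "g \<in> borel_measurable borel" "?G \<in> borel_measurable borel"
    using g by simp_all
  \<comment> \<open>The mass of the Gaussian is its own transform at the origin.\<close>
  have int_gaussian: "(LINT u|lborel. gaussian (u::'a)) = ?c"
  proof -
    have "complex_of_real (LINT u|lborel. gaussian (u::'a)) = complex_of_real ?c"
      using fourier_integral_gaussian[of "0::'a"] by (simp add: fourier_integral_def gaussian_def)
    then show ?thesis
      by (simp only: of_real_eq_iff)
  qed
  have c2: "?c * ?c = (2 * pi) ^ DIM('a)"
    by (simp only: power_mult_distrib[symmetric] real_sqrt_mult_self) simp
  have gB: "norm (complex_of_real (gaussian u) * g \<xi>) \<le> gaussian u * B" for u \<xi> :: 'a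
    using B[of \<xi>] gaussian_bounds(1)[of u] by (simp add: norm_mult)
  have int_gB: "integrable lborel (\<lambda>u::'a. gaussian u * B)"
    by (simp add: integrable_gaussian)
  have K_lim: "(\<lambda>n. K n \<xi>) \<longlonglongrightarrow> (2 * pi) ^ DIM('a) * g \<xi>" for \<xi>
  proof -
    have "(\<lambda>n. LINT u|lborel. complex_of_real (gaussian u) * g (\<xi> + \<delta> n *\<^sub>R u))
        \<longlonglongrightarrow> (LINT u|lborel. complex_of_real (gaussian (u::'a)) * g \<xi>)"
    proof (rule integral_dominated_convergence[where w = "\<lambda>u. gaussian u * B"])
      show "AE u in lborel. (\<lambda>n. complex_of_real (gaussian u) * g (\<xi> + \<delta> n *\<^sub>R u))
          \<longlonglongrightarrow> complex_of_real (gaussian u) * g \<xi>"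
      proof (intro AE_I2 tendsto_intros isCont_tendsto_compose[OF cont])
        fix u
        have "(\<lambda>n. \<xi> + \<delta> n *\<^sub>R u) \<longlonglongrightarrow> \<xi> + 0 *\<^sub>R u"
          by (intro tendsto_intros \<delta>)
        then show "(\<lambda>n. \<xi> + \<delta> n *\<^sub>R u) \<longlonglongrightarrow> \<xi>" by simp
      qed
      show "AE u in lborel. norm (complex_of_real (gaussian u) * g (\<xi> + \<delta> n *\<^sub>R u)) \<le> gaussian u * B" for n
        by (intro AE_I2 gB)
    qed (use int_gB in measurable)
    then have "(\<lambda>n. K n \<xi>) \<longlonglongrightarrow> ?c * (LINT u|lborel. complex_of_real (gaussian (u::'a)) * g \<xi>)"
      unfolding K_def by (intro tendsto_intros)
    also have "(LINT u|lborel. complex_of_real (gaussian (u::'a)) * g \<xi>) = ?c * g \<xi>"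
      by (simp only: integral_mult_left_zero integral_complex_of_real int_gaussian)
    also have "complex_of_real ?c * (complex_of_real ?c * g \<xi>) = (2 * pi) ^ DIM('a) * g \<xi>"
      by (simp only: c2 flip: mult.assoc of_real_mult)
    finally show ?thesis .
  qed
  have K_bound: "norm (K n \<xi>) \<le> ?c * (?c * B)" for n \<xi>
  proof -
    have "norm (LINT u|lborel. complex_of_real (gaussian u) * g (\<xi> + \<delta> n *\<^sub>R u)) \<le> (LINT u|lborel. gaussian (u::'a) * B)"
    proof (rule Bochner_Integration.integral_norm_bound_integral[OF _ int_gB gB])
      show "integrable lborel (\<lambda>u. complex_of_real (gaussian u) * g (\<xi> + \<delta> n *\<^sub>R u))"
        by (rule Bochner_Integration.integrable_bound[OF int_gB _ AE_I2])
           (measurable, rule order_trans[OF gB], simp)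
    qed
    then show ?thesis
      by (auto simp: K_def norm_mult norm_power int_gaussian intro!: mult_left_mono)
  qed
  have K_meas: "K n \<in> borel_measurable borel" for n
    unfolding K_def by measurable
  have L_eq: "complex_of_real (L n) = (LINT \<xi>|lborel. g \<xi> * cnj (K n \<xi>))" for n
    unfolding L_def K_def integral_complex_of_real[symmetric]
    using fourier_integral_gaussian_regularization[OF g \<delta>(1)[of n]] by simp
  have "(\<lambda>n. complex_of_real (L n)) \<longlonglongrightarrow> (LINT \<xi>|lborel. g \<xi> * cnj ((2 * pi) ^ DIM('a) * g \<xi>))"
    unfolding L_eq
  proof (rule integral_dominated_convergence[where w = "\<lambda>\<xi>. norm (g \<xi>) * (?c * (?c * B))"])
    show "AE \<xi> in lborel. (\<lambda>n. g \<xi> * cnj (K n \<xi>)) \<longlonglongrightarrow> g \<xi> * cnj ((2 * pi) ^ DIM('a) * g \<xi>)"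
      by (intro AE_I2 tendsto_intros K_lim)
    show "AE \<xi> in lborel. norm (g \<xi> * cnj (K n \<xi>)) \<le> norm (g \<xi>) * (?c * (?c * B))" for n
      using K_bound by (intro AE_I2) (simp add: norm_mult mult_left_mono)
  qed (use g K_meas in auto)
  also have "(\<lambda>\<xi>. g \<xi> * cnj ((2 * pi) ^ DIM('a) * g \<xi>)) = (\<lambda>\<xi>. complex_of_real ((2 * pi) ^ DIM('a) * (norm (g \<xi>))\<^sup>2))"
    by (simp add: complex_norm_square mult_ac del: of_real_power)
  finally have "(\<lambda>n. complex_of_real (L n)) \<longlonglongrightarrow> complex_of_real (LINT \<xi>|lborel. (2 * pi) ^ DIM('a) * (norm (g \<xi>))\<^sup>2)"
    by (simp only: integral_complex_of_real)
  then have "L \<longlonglongrightarrow> (2 * pi) ^ DIM('a) * (LINT \<xi>|lborel. (norm (g \<xi>))\<^sup>2)"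
    by (simp only: tendsto_of_real_iff integral_mult_right_zero)
  then have lim1: "(\<lambda>n. ennreal (L n)) \<longlonglongrightarrow> ennreal ((2 * pi) ^ DIM('a) * (LINT \<xi>|lborel. (norm (g \<xi>))\<^sup>2))"
    by (rule tendsto_ennrealI)
  have "(\<lambda>n. \<integral>\<^sup>+x. ennreal (gaussian (\<delta> n *\<^sub>R x) * (norm (?G x))\<^sup>2) \<partial>lborel)
      \<longlonglongrightarrow> (\<integral>\<^sup>+x. ennreal ((norm (?G x))\<^sup>2) \<partial>lborel)"
  proof (rule nn_integral_LIMSEQ)
    show "incseq (\<lambda>n x. ennreal (gaussian (\<delta> n *\<^sub>R x) * (norm (?G x))\<^sup>2))"
    proof (intro incseq_SucI le_funI ennreal_leI mult_right_mono)
      fix n and x :: 'a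
      have "\<delta> (Suc n) \<le> \<delta> n"
        using \<delta>(3) by (simp add: decseq_Suc_iff)
      then have "(norm (\<delta> (Suc n) *\<^sub>R x))\<^sup>2 \<le> (norm (\<delta> n *\<^sub>R x))\<^sup>2"
        using \<delta>(1) by (intro power_mono) (auto intro!: mult_right_mono simp: less_imp_le)
      then show "gaussian (\<delta> n *\<^sub>R x) \<le> gaussian (\<delta> (Suc n) *\<^sub>R x)"
        by (simp add: gaussian_def)
    qed simp
    fix x
    have "(\<lambda>n. gaussian (\<delta> n *\<^sub>R x) * (norm (?G x))\<^sup>2) \<longlonglongrightarrow> gaussian (0 *\<^sub>R x) * (norm (?G x))\<^sup>2"
      unfolding gaussian_def by (intro tendsto_intros \<delta>) simp
    then show "(\<lambda>n. ennreal (gaussian (\<delta> n *\<^sub>R x) * (norm (?G x))\<^sup>2)) \<longlonglongrightarrow> ennreal ((norm (?G x))\<^sup>2)"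
      by (intro tendsto_ennrealI) (simp add: gaussian_def)
  qed measurable
  also have "(\<lambda>n. \<integral>\<^sup>+x. ennreal (gaussian (\<delta> n *\<^sub>R x) * (norm (?G x))\<^sup>2) \<partial>lborel) = (\<lambda>n. ennreal (L n))"
    unfolding L_def
  proof (intro ext nn_integral_eq_integral AE_I2)
    fix n
    show "integrable lborel (\<lambda>x. gaussian (\<delta> n *\<^sub>R x) * (norm (?G x))\<^sup>2)"
    proof (rule Bochner_Integration.integrable_bound)
      show "integrable lborel (\<lambda>x::'a. gaussian (\<delta> n *\<^sub>R x) * (LINT \<xi>|lborel. norm (g \<xi>))\<^sup>2)"
        using integrable_lborel_affine[OF integrable_gaussian, of "\<delta> n" "0::'a"] \<delta>(1)[of n] by simp
    qed (auto simp: gaussian_bounds less_imp_le intro!: mult_left_mono power_mono norm_fourier_integral_le)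
  qed (simp add: gaussian_bounds less_imp_le)
  finally show ?thesis
    using lim1 by (rule LIMSEQ_unique)
qed

section \<open>Schwartz functions and their Fourier transforms\<close>

lemma iter_partial_deriv_append:
  "iter_partial_deriv (js @ ks) f = iter_partial_deriv js (iter_partial_deriv ks f)"
  by (induction js) auto

lemma schwartz_iter_partial_deriv: "schwartz f \<Longrightarrow> schwartz (iter_partial_deriv ks f)"
  unfolding schwartz_def iter_partial_deriv_append[symmetric] by blast

lemma schwartz_partial_deriv: "schwartz f \<Longrightarrow> schwartz (partial_deriv j f)"
  using schwartz_iter_partial_deriv[of f "[j]"] by simp

lemma schwartz_differentiable: "schwartz f \<Longrightarrow> f differentiable (at x)"
  unfolding schwartz_def by (metis iter_partial_deriv.simps(1))

lemma schwartz_isCont: "schwartz f \<Longrightarrow> isCont f x"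
  by (simp add: differentiable_imp_continuous_within schwartz_differentiable)

lemma schwartz_measurable: "schwartz f \<Longrightarrow> f \<in> borel_measurable borel"
  by (intro borel_measurable_continuous_onI continuous_at_imp_continuous_on ballI schwartz_isCont)

lemma one_plus_power_le: "(1 + a) ^ k \<le> 2 ^ k * (1 + a ^ k)" if "0 \<le> a" for a :: real
proof -
  have "(1 + a) ^ k \<le> (2 * max 1 a) ^ k"
    using that by (intro power_mono) auto
  also have "\<dots> \<le> 2 ^ k * (1 + a ^ k)"
    using that by (auto simp: power_mult_distrib max_def)
  finally show ?thesis .
qed

text \<open>Converts bounds for pure powers of the norm, the form in which decay is defined or
  derived, into bounds with a weight that is positive everywhere and can be divided by.\<close>

lemma weighted_bound_from_moments:
  fixes F :: "'a::real_normed_vector \<Rightarrow> complex"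
  assumes B: "\<And>N x. norm x ^ N * norm (F x) \<le> B N"
  shows "(1 + (norm x)\<^sup>2) ^ k * norm (F x) \<le> 2 ^ k * (B 0 + B (2 * k))"
proof -
  have "(1 + (norm x)\<^sup>2) ^ k * norm (F x) \<le> 2 ^ k * (1 + ((norm x)\<^sup>2) ^ k) * norm (F x)"
    by (intro mult_right_mono one_plus_power_le) auto
  also have "\<dots> = 2 ^ k * (norm x ^ 0 * norm (F x) + norm x ^ (2 * k) * norm (F x))"
    by (simp add: algebra_simps flip: power_mult)
  also have "\<dots> \<le> 2 ^ k * (B 0 + B (2 * k))"
    by (intro mult_left_mono add_mono B) auto
  finally show ?thesis .
qed

lemma schwartz_bound:
  assumes "schwartz f"
  obtains B where "\<And>x. (1 + (norm x)\<^sup>2) ^ k * norm (f x) \<le> B"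
proof -
  have "bounded (range (\<lambda>x. norm x ^ N * norm (f x)))" for N
    using assms unfolding schwartz_def by (metis iter_partial_deriv.simps(1))
  then have "\<exists>B. \<forall>x. norm x ^ N * norm (f x) \<le> B" for N
    unfolding bounded_iff by (auto simp: abs_mult)
  then obtain B where B: "\<And>N x. norm x ^ N * norm (f x) \<le> B N"
    by metis
  from weighted_bound_from_moments[OF B] show thesis
    by (rule that)
qed

lemma le_mult_inverse_power:
  assumes "(1 + (norm x)\<^sup>2) ^ k * a \<le> B"
  shows "a \<le> B * inverse ((1 + (norm x)\<^sup>2) ^ k)"
proof -
  have "0 < (1 + (norm x)\<^sup>2) ^ k"
    by (simp add: add_pos_nonneg)
  then show ?thesis
    using assms by (simp add: field_simps)
qed

lemma integrable_of_decay:
  fixes g :: "'a::euclidean_space \<Rightarrow> complex"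
  assumes [measurable]: "g \<in> borel_measurable borel"
    and B: "\<And>x. (1 + (norm x)\<^sup>2) ^ DIM('a) * norm (g x) \<le> B"
  shows "integrable lborel g"
proof (rule Bochner_Integration.integrable_bound)
  show "integrable lborel (\<lambda>x::'a. B * inverse ((1 + (norm x)\<^sup>2) ^ DIM('a)))"
    using integrable_inverse_norm_power by (rule integrable_mult_right)
  show "AE x in lborel. norm (g x) \<le> norm (B * inverse ((1 + (norm x)\<^sup>2) ^ DIM('a)))"
    by (intro AE_I2 order_trans[OF le_mult_inverse_power[OF B]]) simp
qed simp

lemma schwartz_integrable:
  fixes f :: "real ^ 'n::finite \<Rightarrow> complex"
  assumes "schwartz f"
  shows "integrable lborel f"
proof -
  obtain B where "\<And>x. (1 + (norm x)\<^sup>2) ^ DIM(real ^ 'n) * norm (f x) \<le> B"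
    using schwartz_bound[OF assms] by blast
  then show ?thesis
    by (rule integrable_of_decay[OF schwartz_measurable[OF assms]])
qed

lemma fourier_transform_eq: "fourier_transform f \<xi> = fourier_integral f (- \<xi>)"
  by (simp add: fourier_transform_def fourier_integral_def inner_commute)

lemma isCont_fourier_transform:
  assumes "schwartz f"
  shows "isCont (fourier_transform f) \<xi>"
proof -
  have "isCont (\<lambda>\<xi>. fourier_integral f (- \<xi>)) \<xi>"
    by (rule isCont_o2[OF _ isCont_fourier_integral[OF schwartz_integrable[OF assms]]]) simp
  then show ?thesis
    by (simp only: fourier_transform_eq[abs_def])
qed

section \<open>Derivatives and decay on the Fourier side\<close>

lemma schwartz_directional_derivative:
  assumes "schwartz f"
  shows "((\<lambda>h. f (x + h *\<^sub>R axis j 1)) has_vector_derivative partial_deriv j f (x + h *\<^sub>R axis j 1)) (at h within S)"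
proof -
  let ?F = "frechet_derivative f (at (x + h *\<^sub>R axis j 1))"
  have F: "(f has_derivative ?F) (at (x + h *\<^sub>R axis j 1))"
    using schwartz_differentiable[OF assms] by (simp add: frechet_derivative_works)
  have "((\<lambda>h. x + h *\<^sub>R axis j 1) has_derivative (\<lambda>k. k *\<^sub>R axis j 1)) (at h within S)"
    by (auto intro!: derivative_eq_intros)
  from has_derivative_compose[OF this F]
  have "((\<lambda>h. f (x + h *\<^sub>R axis j 1)) has_derivative (\<lambda>k. ?F (k *\<^sub>R axis j 1))) (at h within S)" .
  moreover have "?F (k *\<^sub>R axis j 1) = k *\<^sub>R partial_deriv j f (x + h *\<^sub>R axis j 1)" for k
    using linear_scale[OF has_derivative_linear[OF F]] by (simp add: partial_deriv_def)
  ultimately show ?thesis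
    by (simp add: has_vector_derivative_def)
qed

text \<open>Compares the weights at two points at distance at most 1. From (a + 1)^2 \<le> 2 a^2 + 2
  the left side is at most 3 + 2 a^2, whence the constant 3.\<close>

lemma one_plus_norm_square_shift:
  fixes x y :: "'a::real_normed_vector"
  assumes "norm y \<le> 1"
  shows "1 + (norm x)\<^sup>2 \<le> 3 * (1 + (norm (x + y))\<^sup>2)"
proof -
  have "norm x \<le> norm (x + y) + 1"
    using norm_triangle_ineq4[of "x + y" y] assms by simp
  then have "(norm x)\<^sup>2 \<le> (norm (x + y) + 1)\<^sup>2"
    by (intro power_mono) auto
  also have "\<dots> \<le> 2 * (norm (x + y))\<^sup>2 + 2"
    using zero_le_power2[of "norm (x + y) - 1"] by (simp add: power2_eq_square algebra_simps)
  finally show ?thesis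
    by (rule order_trans[OF add_left_mono]) (simp add: algebra_simps)
qed

text \<open>The bound is uniform in \<open>h\<close>, so that it yields a majorant for dominated
  convergence. By the mean value inequality the quotient is controlled by the partial derivative on
  a segment of length at most 1, along which the weight changes by at most 3^k.\<close>

lemma schwartz_difference_quotient_bound:
  fixes f :: "real ^ 'n::finite \<Rightarrow> complex"
  assumes f: "schwartz f"
  obtains B where "\<And>x h. 0 < h \<Longrightarrow> h \<le> 1 \<Longrightarrow>
    (1 + (norm x)\<^sup>2) ^ k * norm ((f (x + h *\<^sub>R axis j 1) - f x) /\<^sub>R h) \<le> B"
proof -
  obtain B where B: "\<And>x. (1 + (norm x)\<^sup>2) ^ k * norm (partial_deriv j f x) \<le> B"
    using schwartz_bound[OF schwartz_partial_deriv[OF f]] by blast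
  have B0: "0 \<le> B"
    by (rule order_trans[OF _ B[of 0]]) simp
  show thesis
  proof
    fix x :: "real ^ 'n" and h :: real assume h: "0 < h" "h \<le> 1"
    define b where "b = 3 ^ k * B * inverse ((1 + (norm x)\<^sup>2) ^ k)"
    have pos: "0 < (1 + (norm x)\<^sup>2) ^ k"
      by (simp add: add_pos_nonneg)
    have D: "norm (partial_deriv j f (x + t *\<^sub>R axis j 1)) \<le> b" if "t \<in> {0..h}" for t
    proof -
      let ?y = "x + t *\<^sub>R axis j 1"
      have "(1 + (norm x)\<^sup>2) ^ k * norm (partial_deriv j f ?y)
          \<le> (3 * (1 + (norm ?y)\<^sup>2)) ^ k * norm (partial_deriv j f ?y)"
        using that h by (intro mult_right_mono power_mono one_plus_norm_square_shift) auto
      also have "\<dots> = 3 ^ k * ((1 + (norm ?y)\<^sup>2) ^ k * norm (partial_deriv j f ?y))"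
        by (simp only: power_mult_distrib mult.assoc)
      also have "\<dots> \<le> 3 ^ k * B"
        by (intro mult_left_mono B) simp
      finally show ?thesis
        unfolding b_def by (rule le_mult_inverse_power)
    qed
    have "norm (f (x + h *\<^sub>R axis j 1) - f (x + 0 *\<^sub>R axis j 1)) \<le> b * norm (h - 0)"
    proof (rule differentiable_bound[OF convex_real_interval(5)])
      show "((\<lambda>h. f (x + h *\<^sub>R axis j 1)) has_derivative (\<lambda>k. k *\<^sub>R partial_deriv j f (x + t *\<^sub>R axis j 1))) (at t within {0..h})" for t
        using schwartz_directional_derivative[OF f] by (simp add: has_vector_derivative_def)
      show "onorm (\<lambda>k. k *\<^sub>R partial_deriv j f (x + t *\<^sub>R axis j 1)) \<le> b" if "t \<in> {0..h}" for t
        using D[OF that] by (intro onorm_le) (simp add: mult_left_mono mult.commute[of b])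
    qed (use h in auto)
    then have "norm ((f (x + h *\<^sub>R axis j 1) - f x) /\<^sub>R h) \<le> b"
      using h by (simp only: norm_scaleR) (simp add: field_simps)
    then show "(1 + (norm x)\<^sup>2) ^ k * norm ((f (x + h *\<^sub>R axis j 1) - f x) /\<^sub>R h) \<le> 3 ^ k * B"
      using pos by (simp add: b_def field_simps)
  qed
qed

lemma has_vector_derivative_difference_quotient:
  assumes "(f has_vector_derivative D) (at x)"
  shows "((\<lambda>h. (f (x + h) - f x) /\<^sub>R h) \<longlongrightarrow> D) (at 0)"
proof -
  have lim: "((\<lambda>h. norm (f (x + h) - f x - h *\<^sub>R D) / norm h) \<longlongrightarrow> 0) (at 0)"
    using assms unfolding has_vector_derivative_def has_derivative_at by blast
  have "norm (f (x + h) - f x - h *\<^sub>R D) / norm h = norm ((f (x + h) - f x) /\<^sub>R h - D)" if "h \<noteq> 0" for h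
  proof -
    have "(f (x + h) - f x) /\<^sub>R h - D = (f (x + h) - f x - h *\<^sub>R D) /\<^sub>R h"
      using that by (simp add: scaleR_diff_right)
    then show ?thesis
      by (simp add: divide_inverse mult.commute)
  qed
  then have "\<forall>\<^sub>F h in at 0. norm (f (x + h) - f x - h *\<^sub>R D) / norm h = norm ((f (x + h) - f x) /\<^sub>R h - D)"
    by (simp add: eventually_at_filter)
  from Lim_transform_eventually[OF lim this] have "((\<lambda>h. (f (x + h) - f x) /\<^sub>R h - D) \<longlongrightarrow> 0) (at 0)"
    by (rule tendsto_norm_zero_cancel)
  then show ?thesis
    by (rule LIM_zero_cancel)
qed

text \<open>Instead of integrating by parts, we pass to the limit in the Fourier transform of difference
  quotients, which by translation invariance are multiplied by \<open>(exp (\<i> h \<xi>\<^sub>j) - 1) / h\<close>.\<close>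

lemma fourier_transform_partial_deriv:
  fixes f :: "real ^ 'n::finite \<Rightarrow> complex"
  assumes f: "schwartz f"
  shows "fourier_transform (partial_deriv j f) \<xi> = \<i> * (\<xi> $ j) * fourier_transform f \<xi>"
proof -
  let ?e = "axis j 1 :: real ^ 'n"
  define \<delta> where "\<delta> n = 1 / real (Suc n)" for n
  have \<delta>: "0 < \<delta> n" "\<delta> n \<le> 1" "\<delta> \<longlonglongrightarrow> 0" for n
    using LIMSEQ_inverse_real_of_nat by (auto simp: \<delta>_def[abs_def] inverse_eq_divide)
  then have \<delta>_at: "filterlim \<delta> (at 0) sequentially"
    by (auto simp: filterlim_at intro!: always_eventually) (metis less_irrefl)
  define Q where "Q n x = (f (x + \<delta> n *\<^sub>R ?e) - f x) /\<^sub>R \<delta> n" for n x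
  have [measurable]: "f \<in> borel_measurable borel" "partial_deriv j f \<in> borel_measurable borel"
    using f by (auto intro: schwartz_measurable schwartz_partial_deriv)
  obtain B where B: "\<And>x h. 0 < h \<Longrightarrow> h \<le> 1 \<Longrightarrow>
      (1 + (norm x)\<^sup>2) ^ DIM(real ^ 'n) * norm ((f (x + h *\<^sub>R ?e) - f x) /\<^sub>R h) \<le> B"
    using schwartz_difference_quotient_bound[OF f] by blast
  have "(\<lambda>n. fourier_transform (Q n) \<xi>) \<longlonglongrightarrow> fourier_transform (partial_deriv j f) \<xi>"
    unfolding fourier_transform_eq fourier_integral_def
  proof (rule integral_dominated_convergence[where w = "\<lambda>x. B * inverse ((1 + (norm x)\<^sup>2) ^ DIM(real ^ 'n))"])
    show "integrable lborel (\<lambda>x::real ^ 'n. B * inverse ((1 + (norm x)\<^sup>2) ^ DIM(real ^ 'n)))"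
      using integrable_inverse_norm_power by (rule integrable_mult_right)
    show "AE x in lborel. norm (iexp (- \<xi> \<bullet> x) * Q n x) \<le> B * inverse ((1 + (norm x)\<^sup>2) ^ DIM(real ^ 'n))" for n
      unfolding Q_def norm_mult norm_exp_i_times mult_1
      by (intro AE_I2 le_mult_inverse_power B \<delta>)
    show "AE x in lborel. (\<lambda>n. iexp (- \<xi> \<bullet> x) * Q n x) \<longlonglongrightarrow> iexp (- \<xi> \<bullet> x) * partial_deriv j f x"
    proof (intro AE_I2 tendsto_intros)
      fix x
      have "((\<lambda>h. (f (x + h *\<^sub>R ?e) - f x) /\<^sub>R h) \<longlongrightarrow> partial_deriv j f x) (at 0)"
        using has_vector_derivative_difference_quotient[OF schwartz_directional_derivative[OF f, of x j 0 UNIV]]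
        by simp
      from filterlim_compose[OF this \<delta>_at] show "(\<lambda>n. Q n x) \<longlonglongrightarrow> partial_deriv j f x"
        by (simp add: Q_def)
    qed
  qed (auto simp: Q_def)
  moreover have "(\<lambda>n. fourier_transform (Q n) \<xi>) \<longlonglongrightarrow> \<i> * (\<xi> $ j) * fourier_transform f \<xi>"
  proof -
    have "fourier_transform (Q n) \<xi> = (iexp (\<delta> n * \<xi> $ j) - 1) / \<delta> n * fourier_transform f \<xi>" for n
    proof -
      have int: "integrable lborel (\<lambda>x. iexp (- \<xi> \<bullet> x) * f x)"
        by (intro integrable_iexp_mult schwartz_integrable f)
      have int': "integrable lborel (\<lambda>x. iexp (- \<xi> \<bullet> x) * f (\<delta> n *\<^sub>R ?e + x))"
        using integrable_lborel_affine[OF schwartz_integrable[OF f], of 1 "\<delta> n *\<^sub>R ?e"]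
        by (intro integrable_iexp_mult) simp
      have "fourier_integral f (- \<xi>) = (LINT x|lborel. iexp (- \<xi> \<bullet> (\<delta> n *\<^sub>R ?e + x)) * f (\<delta> n *\<^sub>R ?e + x))"
        unfolding fourier_integral_def by (subst integral_lborel_affine[where c = 1 and t = "\<delta> n *\<^sub>R ?e"]) auto
      also have "\<dots> = (LINT x|lborel. iexp (- (\<delta> n * \<xi> $ j)) * (iexp (- \<xi> \<bullet> x) * f (\<delta> n *\<^sub>R ?e + x)))"
      proof -
        have "- \<xi> \<bullet> (\<delta> n *\<^sub>R ?e + x) = - (\<delta> n * \<xi> $ j) + - \<xi> \<bullet> x" for x
          by (simp add: inner_add_right inner_axis)
        then show ?thesis
          by (simp only: of_real_add distrib_left exp_add mult.assoc)
      qed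
      finally have "fourier_integral f (- \<xi>)
          = iexp (- (\<delta> n * \<xi> $ j)) * (LINT x|lborel. iexp (- \<xi> \<bullet> x) * f (\<delta> n *\<^sub>R ?e + x))"
        by (simp only: integral_mult_right_zero)
      moreover have "iexp (\<delta> n * \<xi> $ j) * iexp (- (\<delta> n * \<xi> $ j)) = 1"
        by (simp add: exp_minus)
      ultimately have "(LINT x|lborel. iexp (- \<xi> \<bullet> x) * f (\<delta> n *\<^sub>R ?e + x)) = iexp (\<delta> n * \<xi> $ j) * fourier_integral f (- \<xi>)"
        by (simp only: mult.assoc[symmetric] mult_1)
      moreover have "fourier_integral (Q n) (- \<xi>)
          = (LINT x|lborel. (iexp (- \<xi> \<bullet> x) * f (\<delta> n *\<^sub>R ?e + x) - iexp (- \<xi> \<bullet> x) * f x) /\<^sub>R \<delta> n)"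
        unfolding fourier_integral_def Q_def by (simp add: algebra_simps scaleR_conv_of_real)
      ultimately show ?thesis
        using int int' \<delta>(1)[of n]
        by (simp add: fourier_transform_eq fourier_integral_def scaleR_conv_of_real field_simps)
    qed
    moreover have "(\<lambda>n. (iexp (\<delta> n * \<xi> $ j) - 1) / \<delta> n) \<longlonglongrightarrow> \<i> * (\<xi> $ j)"
    proof -
      \<comment> \<open>The limit of the multipliers is the derivative at 0 of an entire function,
        restricted to the real line.\<close>
      have "((\<lambda>z. exp (\<i> * (z * complex_of_real (\<xi> $ j)))) has_field_derivative \<i> * (\<xi> $ j)) (at (of_real 0))"
        by (auto intro!: derivative_eq_intros)
      from has_vector_derivative_real_field[OF this, of UNIV]
      have "((\<lambda>h. iexp (h * \<xi> $ j)) has_vector_derivative \<i> * (\<xi> $ j)) (at 0)"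
        by simp
      then have "((\<lambda>h. (iexp (h * \<xi> $ j) - 1) /\<^sub>R h) \<longlongrightarrow> \<i> * (\<xi> $ j)) (at 0)"
        by (auto dest: has_vector_derivative_difference_quotient)
      from filterlim_compose[OF this \<delta>_at] show ?thesis
        by (simp add: scaleR_conv_of_real divide_inverse mult.commute)
    qed
    ultimately show ?thesis
      by (simp only: tendsto_mult_right)
  qed
  ultimately show ?thesis
    by (rule LIMSEQ_unique)
qed

text \<open>Repeated differentiation in one coordinate multiplies the transform by a power of that
  coordinate, and the transform of an integrable function is bounded. This controls powers of single
  coordinates; the norm is at most the dimension times the largest coordinate.\<close>

lemma fourier_transform_decay:
  fixes f :: "real ^ 'n::finite \<Rightarrow> complex"
  assumes f: "schwartz f"
  obtains B where "\<And>\<xi>. (1 + (norm \<xi>)\<^sup>2) ^ k * norm (fourier_transform f \<xi>) \<le> B"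
proof -
  define D where "D j N = iter_partial_deriv (replicate N j) f" for j N
  define M where "M j N = (LINT x|lborel. norm (D j N x))" for j N
  have D: "schwartz (D j N)" for j N
    unfolding D_def by (rule schwartz_iter_partial_deriv[OF f])
  have D_hat: "fourier_transform (D j N) \<xi> = (\<i> * (\<xi> $ j)) ^ N * fourier_transform f \<xi>" for j N \<xi>
  proof (induction N)
    case (Suc N)
    have "D j (Suc N) = partial_deriv j (D j N)"
      by (simp add: D_def)
    then show ?case
      by (simp add: fourier_transform_partial_deriv[OF D] Suc)
  qed (simp add: D_def)
  have M: "\<bar>\<xi> $ j\<bar> ^ N * norm (fourier_transform f \<xi>) \<le> M j N" for j N \<xi>
    using norm_fourier_integral_le[of "D j N" "- \<xi>"] D_hat[of j N \<xi>]
    by (simp add: fourier_transform_eq M_def norm_mult norm_power)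
  define B where "B N = real CARD('n) ^ N * (\<Sum>j\<in>UNIV. M j N)" for N
  have B: "norm \<xi> ^ N * norm (fourier_transform f \<xi>) \<le> B N" for N \<xi>
  proof -
    have "Max (range (\<lambda>i. \<bar>\<xi> $ i\<bar>)) \<in> range (\<lambda>i. \<bar>\<xi> $ i\<bar>)"
      by (intro Max_in) auto
    then obtain j where "Max (range (\<lambda>i. \<bar>\<xi> $ i\<bar>)) = \<bar>\<xi> $ j\<bar>"
      by (rule rangeE)
    then have j: "\<bar>\<xi> $ i\<bar> \<le> \<bar>\<xi> $ j\<bar>" for i
      by (metis Max_ge finite finite_imageI rangeI)
    have "norm \<xi> \<le> (\<Sum>i\<in>UNIV. \<bar>\<xi> $ i\<bar>)"
      by (rule norm_le_l1_cart)
    also have "\<dots> \<le> real CARD('n) * \<bar>\<xi> $ j\<bar>"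
      using sum_bounded_above[of UNIV "\<lambda>i. \<bar>\<xi> $ i\<bar>" "\<bar>\<xi> $ j\<bar>"] j by simp
    finally have "norm \<xi> ^ N * norm (fourier_transform f \<xi>) \<le> (real CARD('n) * \<bar>\<xi> $ j\<bar>) ^ N * norm (fourier_transform f \<xi>)"
      by (intro mult_right_mono power_mono) auto
    also have "\<dots> = real CARD('n) ^ N * (\<bar>\<xi> $ j\<bar> ^ N * norm (fourier_transform f \<xi>))"
      by (simp add: power_mult_distrib)
    also have "\<dots> \<le> real CARD('n) ^ N * M j N"
      by (intro mult_left_mono M) simp
    \<comment> \<open>The index \<open>j\<close> of the largest coordinate depends on \<xi>; summing
      over all indices makes the bound uniform.\<close>
    also have "\<dots> \<le> B N"
      unfolding B_def by (intro mult_left_mono member_le_sum) (auto simp: M_def)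
    finally show ?thesis .
  qed
  from weighted_bound_from_moments[OF B] show thesis
    by (rule that)
qed

section \<open>Conjugation and dilation of Schwartz functions\<close>

lemma partial_deriv_cnj:
  assumes "g differentiable (at x)"
  shows "partial_deriv j (\<lambda>x. cnj (g x)) x = cnj (partial_deriv j g x)"
proof -
  have "((\<lambda>x. cnj (g x)) has_derivative (\<lambda>h. cnj (frechet_derivative g (at x) h))) (at x)"
    using assms by (intro bounded_linear.has_derivative[OF bounded_linear_cnj]) (simp add: frechet_derivative_works)
  from frechet_derivative_at[OF this] show ?thesis
    by (simp add: partial_deriv_def fun_eq_iff)
qed

text \<open>The scalar \<open>c\<close> is carried for the induction on iterated derivatives, where
  each derivative contributes one more factor \<open>R\<close>.\<close>

lemma partial_deriv_dilation:
  assumes "g differentiable (at (R *\<^sub>R x))"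
  shows "partial_deriv j (\<lambda>x. c *\<^sub>R g (R *\<^sub>R x)) x = (c * R) *\<^sub>R partial_deriv j g (R *\<^sub>R x)"
proof -
  let ?F = "frechet_derivative g (at (R *\<^sub>R x))"
  have F: "(g has_derivative ?F) (at (R *\<^sub>R x))"
    using assms by (simp add: frechet_derivative_works)
  have "((\<lambda>x. R *\<^sub>R x) has_derivative (\<lambda>h. R *\<^sub>R h)) (at x)"
    by (auto intro!: derivative_eq_intros)
  from has_derivative_scaleR_right[OF has_derivative_compose[OF this F], of c]
  have "((\<lambda>x. c *\<^sub>R g (R *\<^sub>R x)) has_derivative (\<lambda>h. c *\<^sub>R ?F (R *\<^sub>R h))) (at x)" .
  from frechet_derivative_at[OF this] show ?thesis
    using linear_scale[OF has_derivative_linear[OF F]] by (simp add: partial_deriv_def fun_eq_iff)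
qed

lemma iter_partial_deriv_differentiable:
  "schwartz f \<Longrightarrow> iter_partial_deriv js f differentiable (at x)"
  by (simp add: schwartz_def)

lemma schwartz_cnj:
  fixes f :: "real ^ 'n::finite \<Rightarrow> complex"
  assumes f: "schwartz f"
  shows "schwartz (\<lambda>x. cnj (f x))"
proof -
  have iter: "iter_partial_deriv js (\<lambda>x. cnj (f x)) = (\<lambda>x. cnj (iter_partial_deriv js f x))" for js
    by (induction js) (auto simp: partial_deriv_cnj iter_partial_deriv_differentiable[OF f])
  have "(\<lambda>x. cnj (g x)) differentiable (at x)" if "g differentiable (at x)" for g :: "real ^ 'n \<Rightarrow> complex" and x
    using that bounded_linear.has_derivative[OF bounded_linear_cnj] unfolding differentiable_def by blast
  then show ?thesis
    using f unfolding schwartz_def iter complex_mod_cnj by blast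
qed

lemma schwartz_dilation:
  assumes f: "schwartz f" and R: "R > 0"
  shows "schwartz (\<lambda>x. f (R *\<^sub>R x))"
proof -
  have iter: "iter_partial_deriv js (\<lambda>x. f (R *\<^sub>R x)) = (\<lambda>x. R ^ length js *\<^sub>R iter_partial_deriv js f (R *\<^sub>R x))" for js
    by (induction js) (auto simp: partial_deriv_dilation iter_partial_deriv_differentiable[OF f] mult.commute)
  show ?thesis
    unfolding schwartz_def iter
  proof (intro allI conjI)
    fix js x N
    have "(\<lambda>x. iter_partial_deriv js f (R *\<^sub>R x)) differentiable (at x)"
      by (rule differentiable_compose[OF iter_partial_deriv_differentiable[OF f]]) (auto intro!: derivative_intros)
    then show "(\<lambda>x. R ^ length js *\<^sub>R iter_partial_deriv js f (R *\<^sub>R x)) differentiable (at x)"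
      by (auto intro!: derivative_intros)
    have "bounded (range (\<lambda>x. norm x ^ N * norm (iter_partial_deriv js f x)))"
      using f by (simp add: schwartz_def)
    then obtain B where "\<forall>x\<in>range (\<lambda>x. norm x ^ N * norm (iter_partial_deriv js f x)). norm x \<le> B"
      unfolding bounded_iff by blast
    then have B: "norm x ^ N * norm (iter_partial_deriv js f x) \<le> B" for x
      by (auto simp: abs_mult)
    have "norm x ^ N * norm (R ^ length js *\<^sub>R iter_partial_deriv js f (R *\<^sub>R x))
        = R ^ length js / R ^ N * (norm (R *\<^sub>R x) ^ N * norm (iter_partial_deriv js f (R *\<^sub>R x)))" for x
      using R by (simp add: power_mult_distrib)
    also have "\<dots> x \<le> R ^ length js / R ^ N * B" for x
      using R by (intro mult_left_mono B) auto
    finally show "bounded (range (\<lambda>x. norm x ^ N * norm (R ^ length js *\<^sub>R iter_partial_deriv js f (R *\<^sub>R x))))"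
      by (auto simp: bounded_iff abs_mult)
  qed
qed

lemma fourier_transform_cnj: "fourier_transform (\<lambda>x. cnj (f x)) \<xi> = cnj (fourier_transform f (- \<xi>))"
proof -
  have "fourier_transform (\<lambda>x. cnj (f x)) \<xi> = (LINT x|lborel. cnj (exp (- \<i> * complex_of_real (x \<bullet> - \<xi>)) * f x))"
    by (simp add: fourier_transform_def exp_cnj)
  then show ?thesis
    by (simp only: Bochner_Integration.integral_cnj fourier_transform_def)
qed

lemma fourier_transform_dilation:
  fixes f :: "real ^ 'n::finite \<Rightarrow> complex"
  assumes f: "schwartz f" and R: "R > 0"
  shows "fourier_transform (\<lambda>x. f (R *\<^sub>R x)) \<xi> = fourier_transform f (\<xi> /\<^sub>R R) /\<^sub>R R ^ CARD('n)"
proof -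
  have [measurable]: "f \<in> borel_measurable borel"
    by (rule schwartz_measurable[OF f])
  have meas: "(\<lambda>x. exp (- \<i> * complex_of_real (x \<bullet> (\<xi> /\<^sub>R R))) * f x) \<in> borel_measurable borel"
    by measurable
  have *: "(0 + R *\<^sub>R x) \<bullet> (\<xi> /\<^sub>R R) = x \<bullet> \<xi>" for x
    using R by simp
  have "fourier_transform f (\<xi> /\<^sub>R R) = R ^ CARD('n) *\<^sub>R fourier_transform (\<lambda>x. f (R *\<^sub>R x)) \<xi>"
    using integral_lborel_affine[OF meas, of R 0] R unfolding fourier_transform_def * by simp
  then show ?thesis
    using R by simp
qed

lemma fourier_transform_measurable: "schwartz f \<Longrightarrow> fourier_transform f \<in> borel_measurable borel"
  by (intro borel_measurable_continuous_onI continuous_at_imp_continuous_on ballI isCont_fourier_transform)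

section \<open>Sobolev norms on the Fourier side\<close>

text \<open>Provides the hypotheses of \<open>plancherel\<close>. The symbol need only be continuous
  and of polynomial growth, which the rapid decay of the transform absorbs.\<close>

lemma weighted_fourier_transform:
  fixes f :: "real ^ 'n::finite \<Rightarrow> complex" and m :: "real ^ 'n \<Rightarrow> real"
  assumes f: "schwartz f" and m: "\<And>\<xi>. isCont m \<xi>" "\<And>\<xi>. \<bar>m \<xi>\<bar> \<le> (1 + (norm \<xi>)\<^sup>2) ^ k"
  obtains B where "integrable lborel (\<lambda>\<xi>. complex_of_real (m \<xi>) * fourier_transform f \<xi>)"
    and "\<And>\<xi>. isCont (\<lambda>\<xi>. complex_of_real (m \<xi>) * fourier_transform f \<xi>) \<xi>"
    and "\<And>\<xi>. norm (complex_of_real (m \<xi>) * fourier_transform f \<xi>) \<le> B"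
proof -
  let ?g = "\<lambda>\<xi>. complex_of_real (m \<xi>) * fourier_transform f \<xi>"
  have cont: "isCont ?g \<xi>" for \<xi>
    by (intro continuous_intros m isCont_fourier_transform f)
  then have meas: "?g \<in> borel_measurable borel"
    by (intro borel_measurable_continuous_onI continuous_at_imp_continuous_on ballI)
  have decay: "(1 + (norm \<xi>)\<^sup>2) ^ n * norm (?g \<xi>) \<le> (1 + (norm \<xi>)\<^sup>2) ^ (n + k) * norm (fourier_transform f \<xi>)" for n \<xi>
    unfolding power_add norm_mult norm_of_real mult.assoc
    by (intro mult_left_mono mult_right_mono m) auto
  \<comment> \<open>The exponent \<open>k\<close> offsets the growth of the symbol and gives
    boundedness; a further \<open>DIM(real ^ 'n)\<close> powers of the weight give
    integrability.\<close>
  obtain B where B: "\<And>\<xi>. (1 + (norm \<xi>)\<^sup>2) ^ (0 + k) * norm (fourier_transform f \<xi>) \<le> B"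
    using fourier_transform_decay[OF f] by blast
  obtain B' where B': "\<And>\<xi>. (1 + (norm \<xi>)\<^sup>2) ^ (DIM(real ^ 'n) + k) * norm (fourier_transform f \<xi>) \<le> B'"
    using fourier_transform_decay[OF f] by blast
  have "integrable lborel ?g"
    by (rule integrable_of_decay[OF meas order_trans[OF decay B']])
  moreover have "norm (?g \<xi>) \<le> B" for \<xi>
    using order_trans[OF decay[where n = 0 and \<xi> = \<xi>] B] by simp
  ultimately show thesis
    using cont that by blast
qed

lemma fourier_transform_integrable: "schwartz f \<Longrightarrow> integrable lborel (fourier_transform f)"
  by (rule weighted_fourier_transform[where m = "\<lambda>_. 1" and k = 0]) auto

section \<open>Powers and L^p norms with extended nonnegative values\<close>

lemma ennreal_powr_ennreal: "0 \<le> a \<Longrightarrow> ennreal_powr (ennreal a) p = ennreal (a powr p)"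
  by (simp add: ennreal_powr_def)

lemma ennreal_powr_mono: "x \<le> y \<Longrightarrow> 0 \<le> p \<Longrightarrow> ennreal_powr x p \<le> ennreal_powr y p"
  by (cases x; cases y) (auto simp: ennreal_powr_def powr_mono2 top_unique)

lemma ennreal_powr_inverse:
  assumes "p > 0"
  shows "ennreal_powr (ennreal_powr x p) (1 / p) = x" "ennreal_powr (ennreal_powr x (1 / p)) p = x"
  using assms by (cases x; simp add: ennreal_powr_def powr_powr)+

text \<open>For p > 0 the power map is an order isomorphism with inverse exponent 1/p. This form
  lets powers commute with suprema and outer roots be moved across inequalities.\<close>

lemma ennreal_powr_le_iff:
  assumes "p > 0"
  shows "ennreal_powr x p \<le> y \<longleftrightarrow> x \<le> ennreal_powr y (1 / p)"
  using ennreal_powr_mono[of "ennreal_powr x p" y "1 / p"] ennreal_powr_mono[of x "ennreal_powr y (1 / p)" p]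
    ennreal_powr_inverse[OF assms] assms by auto

lemma ennreal_powr_SUP:
  assumes "p > 0"
  shows "ennreal_powr (SUP i\<in>I. a i) p = (SUP i\<in>I. ennreal_powr (a i) p)"
proof (rule antisym)
  have "a i \<le> ennreal_powr (SUP i\<in>I. ennreal_powr (a i) p) (1 / p)" if "i \<in> I" for i
    using that unfolding ennreal_powr_le_iff[OF assms, symmetric] by (rule SUP_upper)
  then show "ennreal_powr (SUP i\<in>I. a i) p \<le> (SUP i\<in>I. ennreal_powr (a i) p)"
    unfolding ennreal_powr_le_iff[OF assms] by (rule SUP_least)
  show "(SUP i\<in>I. ennreal_powr (a i) p) \<le> ennreal_powr (SUP i\<in>I. a i) p"
    using assms by (intro SUP_least ennreal_powr_mono SUP_upper) auto
qed

lemma Lp_norm_le_iff: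
  assumes "p > 0" "0 \<le> K"
  shows "Lp_norm p M g \<le> ennreal K \<longleftrightarrow> (\<integral>\<^sup>+x. ennreal_powr (g x) p \<partial>M) \<le> ennreal (K powr p)"
  using assms ennreal_powr_le_iff[of "1 / p"] by (simp add: Lp_norm_def ennreal_powr_ennreal)

text \<open>The squared normalization of the inverse transform gives (2 pi)^(-2d) and Plancherel
  gives (2 pi)^d, which leaves (2 pi)^(-d).\<close>

lemma fourier_multiplier_L2:
  fixes f :: "real ^ 'n::finite \<Rightarrow> complex" and m :: "real ^ 'n \<Rightarrow> real"
  assumes f: "schwartz f" and m: "\<And>\<xi>. isCont m \<xi>" "\<And>\<xi>. \<bar>m \<xi>\<bar> \<le> (1 + (norm \<xi>)\<^sup>2) ^ k"
  shows "integrable lborel (\<lambda>\<xi>. (m \<xi>)\<^sup>2 * (norm (fourier_transform f \<xi>))\<^sup>2)" (is "integrable _ ?h")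
    and "Lp_norm 2 lborel (\<lambda>x. ennreal (norm (fourier_multiplier m f x)))
      = ennreal (sqrt ((LINT \<xi>|lborel. (m \<xi>)\<^sup>2 * (norm (fourier_transform f \<xi>))\<^sup>2) / (2 * pi) ^ CARD('n)))"
proof -
  let ?g = "\<lambda>\<xi>. complex_of_real (m \<xi>) * fourier_transform f \<xi>"
  obtain B where B: "integrable lborel ?g" "\<And>\<xi>. isCont ?g \<xi>" "\<And>\<xi>. norm (?g \<xi>) \<le> B"
    using weighted_fourier_transform[OF f m] by blast
  have h: "?h \<xi> = (norm (?g \<xi>))\<^sup>2" for \<xi>
    by (simp add: norm_mult power_mult_distrib)
  have [measurable]: "?g \<in> borel_measurable borel"
    using B(1) by simp
  show "integrable lborel ?h"
    unfolding h
  proof (rule Bochner_Integration.integrable_bound)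
    show "integrable lborel (\<lambda>\<xi>. B * norm (?g \<xi>))"
      using B(1) by simp
    \<comment> \<open>A bounded integrable function is square integrable: one of the two factors is
      replaced by the bound \<open>B\<close>.\<close>
    have "norm (a\<^sup>2) \<le> norm (b * a)" if "0 \<le> a" "a \<le> b" for a b :: real
      using that by (simp add: power2_eq_square abs_mult mult_right_mono)
    then show "AE \<xi> in lborel. norm ((norm (?g \<xi>))\<^sup>2) \<le> norm (B * norm (?g \<xi>))"
      using B(3) norm_ge_zero by (intro AE_I2) blast
  qed measurable
  have "(\<integral>\<^sup>+x. ennreal_powr (ennreal (norm (fourier_multiplier m f x))) 2 \<partial>lborel)
      = (\<integral>\<^sup>+x. ennreal (1 / ((2 * pi) ^ CARD('n))\<^sup>2) * ennreal ((norm (fourier_integral ?g x))\<^sup>2) \<partial>lborel)"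
  proof (intro nn_integral_cong)
    fix x
    have "norm (fourier_multiplier m f x) = norm (fourier_integral ?g x) / (2 * pi) ^ CARD('n)"
      by (simp add: fourier_multiplier_def fourier_integral_def norm_mult norm_divide norm_power mult.assoc)
    then show "ennreal_powr (ennreal (norm (fourier_multiplier m f x))) 2
        = ennreal (1 / ((2 * pi) ^ CARD('n))\<^sup>2) * ennreal ((norm (fourier_integral ?g x))\<^sup>2)"
      by (simp add: ennreal_powr_ennreal power_divide flip: ennreal_mult)
  qed
  also have "\<dots> = ennreal (1 / ((2 * pi) ^ CARD('n))\<^sup>2) * ennreal ((2 * pi) ^ CARD('n) * (LINT \<xi>|lborel. (norm (?g \<xi>))\<^sup>2))"
    using B(1) plancherel[OF B] by (simp add: nn_integral_cmult)
  also have "\<dots> = ennreal ((LINT \<xi>|lborel. ?h \<xi>) / (2 * pi) ^ CARD('n))"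
    unfolding h by (subst ennreal_mult[symmetric]) (auto simp: power2_eq_square)
  finally show "Lp_norm 2 lborel (\<lambda>x. ennreal (norm (fourier_multiplier m f x)))
      = ennreal (sqrt ((LINT \<xi>|lborel. ?h \<xi>) / (2 * pi) ^ CARD('n)))"
    by (simp add: Lp_norm_def ennreal_powr_ennreal powr_half_sqrt)
qed

text \<open>The values \<open>\<rho> = 1\<close> and \<open>\<rho> = 0\<close> give the squared inhomogeneous and homogeneous
  Sobolev norms; \<open>\<rho> = 1 / R\<^sup>2\<close> arises by rescaling.\<close>

definition sobolev_integral :: "real \<Rightarrow> real \<Rightarrow> (real ^ 'n::finite \<Rightarrow> complex) \<Rightarrow> real" where
  "sobolev_integral \<rho> s f =
     (LINT \<xi>|lborel. (\<rho> + (norm \<xi>)\<^sup>2) powr s * (norm (fourier_transform f \<xi>))\<^sup>2) / (2 * pi) ^ CARD('n)"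

text \<open>Positivity of \<open>s\<close> keeps the symbol continuous where its base vanishes, at
  \<rho> = 0 and \<xi> = 0. As \<rho> \<le> 1, rounding \<open>s\<close> up to a natural number
  gives the required polynomial growth.\<close>

lemma
  fixes f :: "real ^ 'n::finite \<Rightarrow> complex"
  assumes f: "schwartz f" and \<rho>: "0 \<le> \<rho>" "\<rho> \<le> 1" and s: "s > 0"
  shows integrable_sobolev: "integrable lborel (\<lambda>\<xi>. (\<rho> + (norm \<xi>)\<^sup>2) powr s * (norm (fourier_transform f \<xi>))\<^sup>2)"
    and Lp_norm_sobolev: "Lp_norm 2 lborel (\<lambda>x. ennreal (norm (fourier_multiplier (\<lambda>\<xi>. (\<rho> + (norm \<xi>)\<^sup>2) powr (s / 2)) f x)))
      = ennreal (sqrt (sobolev_integral \<rho> s f))"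
proof -
  let ?m = "\<lambda>\<xi>::real ^ 'n. (\<rho> + (norm \<xi>)\<^sup>2) powr (s / 2)"
  have 1: "isCont ?m \<xi>" for \<xi>
    unfolding isCont_def using s \<rho> by (intro tendsto_powr' tendsto_intros) auto
  have 2: "\<bar>?m \<xi>\<bar> \<le> (1 + (norm \<xi>)\<^sup>2) ^ nat \<lceil>s\<rceil>" for \<xi>
  proof -
    have "\<bar>?m \<xi>\<bar> \<le> (1 + (norm \<xi>)\<^sup>2) powr (s / 2)"
      using \<rho> s by (auto intro!: powr_mono2)
    also have "\<dots> \<le> (1 + (norm \<xi>)\<^sup>2) powr real (nat \<lceil>s\<rceil>)"
      by (rule powr_mono) (use s in linarith, simp)
    also have "\<dots> = (1 + (norm \<xi>)\<^sup>2) ^ nat \<lceil>s\<rceil>"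
      by (intro powr_realpow add_pos_nonneg) auto
    finally show ?thesis .
  qed
  have 3: "(?m \<xi>)\<^sup>2 = (\<rho> + (norm \<xi>)\<^sup>2) powr s" for \<xi>
    by (simp add: power2_eq_square flip: powr_add)
  show "integrable lborel (\<lambda>\<xi>. (\<rho> + (norm \<xi>)\<^sup>2) powr s * (norm (fourier_transform f \<xi>))\<^sup>2)"
    using fourier_multiplier_L2(1)[OF f 1 2] by (simp only: 3)
  show "Lp_norm 2 lborel (\<lambda>x. ennreal (norm (fourier_multiplier ?m f x))) = ennreal (sqrt (sobolev_integral \<rho> s f))"
    using fourier_multiplier_L2(2)[OF f 1 2] by (simp only: 3 sobolev_integral_def)
qed

lemma sobolev_norm_eq:
  "schwartz f \<Longrightarrow> s > 0 \<Longrightarrow> sobolev_norm s f = ennreal (sqrt (sobolev_integral 1 s f))"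
  unfolding sobolev_norm_def bessel_potential_def by (rule Lp_norm_sobolev) auto

lemma hom_sobolev_norm_eq:
  fixes f :: "real ^ 'n::finite \<Rightarrow> complex"
  assumes "schwartz f" "s > 0"
  shows "hom_sobolev_norm s f = ennreal (sqrt (sobolev_integral 0 s f))"
proof -
  \<comment> \<open>At the origin both sides are 0, as \<open>0 powr a = 0\<close>.\<close>
  have "norm \<xi> powr s = (0 + (norm \<xi>)\<^sup>2) powr (s / 2)" for \<xi> :: "real ^ 'n"
    by (simp add: powr_powr flip: powr_numeral)
  then show ?thesis
    unfolding hom_sobolev_norm_def riesz_derivative_def using assms by (simp only: Lp_norm_sobolev zero_le_one order_refl)
qed

lemma sobolev_integral_nonneg: "0 \<le> sobolev_integral \<rho> s f"
  unfolding sobolev_integral_def by (intro divide_nonneg_nonneg Bochner_Integration.integral_nonneg) auto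

lemma sobolev_integral_mono:
  assumes "schwartz f" "s > 0"
  shows "sobolev_integral 0 s f \<le> sobolev_integral 1 s f"
  unfolding sobolev_integral_def using assms
  by (intro divide_right_mono integral_mono integrable_sobolev mult_right_mono powr_mono2) auto

lemma sobolev_integral_limit:
  fixes f :: "real ^ 'n::finite \<Rightarrow> complex"
  assumes f: "schwartz f" and s: "s > 0"
  shows "(\<lambda>n. sobolev_integral (1 / (real (Suc n))\<^sup>2) s f) \<longlonglongrightarrow> sobolev_integral 0 s f"
  unfolding sobolev_integral_def
proof (intro tendsto_divide tendsto_const integral_dominated_convergence)
  show "integrable lborel (\<lambda>\<xi>::real ^ 'n. (1 + (norm \<xi>)\<^sup>2) powr s * (norm (fourier_transform f \<xi>))\<^sup>2)"
    by (rule integrable_sobolev[OF f _ _ s]) auto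
  have [measurable]: "fourier_transform f \<in> borel_measurable borel"
    by (rule fourier_transform_measurable[OF f])
  show "(\<lambda>\<xi>. (1 / (real (Suc n))\<^sup>2 + (norm \<xi>)\<^sup>2) powr s * (norm (fourier_transform f \<xi>))\<^sup>2) \<in> borel_measurable lborel" for n
    by measurable
  show "(\<lambda>\<xi>. (0 + (norm \<xi>)\<^sup>2) powr s * (norm (fourier_transform f \<xi>))\<^sup>2) \<in> borel_measurable lborel"
    by measurable
  have "(\<lambda>n. (inverse (real (Suc n)))\<^sup>2) \<longlonglongrightarrow> 0\<^sup>2"
    by (intro tendsto_intros LIMSEQ_inverse_real_of_nat)
  then have lim: "(\<lambda>n. 1 / (real (Suc n))\<^sup>2) \<longlonglongrightarrow> 0"
    by (simp add: inverse_eq_divide power_divide)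
  show "AE \<xi> in lborel. (\<lambda>n. (1 / (real (Suc n))\<^sup>2 + (norm \<xi>)\<^sup>2) powr s * (norm (fourier_transform f \<xi>))\<^sup>2)
      \<longlonglongrightarrow> (0 + (norm \<xi>)\<^sup>2) powr s * (norm (fourier_transform f \<xi>))\<^sup>2"
    \<comment> \<open>At \<xi> = 0 the base of the power tends to 0; the positive exponent keeps the
      limit valid.\<close>
    using s by (intro AE_I2 tendsto_mult tendsto_powr' tendsto_add lim tendsto_const) auto
  show "AE \<xi> in lborel. norm ((1 / (real (Suc n))\<^sup>2 + (norm \<xi>)\<^sup>2) powr s * (norm (fourier_transform f \<xi>))\<^sup>2)
      \<le> (1 + (norm \<xi>)\<^sup>2) powr s * (norm (fourier_transform f \<xi>))\<^sup>2" for n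
  proof (intro AE_I2)
    fix \<xi> :: "real ^ 'n"
    have "1 / (real (Suc n))\<^sup>2 \<le> 1"
      by (simp add: divide_le_eq)
    then show "norm ((1 / (real (Suc n))\<^sup>2 + (norm \<xi>)\<^sup>2) powr s * (norm (fourier_transform f \<xi>))\<^sup>2)
      \<le> (1 + (norm \<xi>)\<^sup>2) powr s * (norm (fourier_transform f \<xi>))\<^sup>2"
      using s unfolding norm_mult by (auto intro!: mult_right_mono powr_mono2)
  qed
qed auto

lemma sobolev_integral_cnj:
  fixes f :: "real ^ 'n::finite \<Rightarrow> complex"
  assumes f: "schwartz f"
  shows "sobolev_integral \<rho> s (\<lambda>x. cnj (f x)) = sobolev_integral \<rho> s f"
proof -
  have [measurable]: "fourier_transform f \<in> borel_measurable borel"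
    by (rule fourier_transform_measurable[OF f])
  show ?thesis
    unfolding sobolev_integral_def fourier_transform_cnj complex_mod_cnj
    by (subst integral_lborel_affine[where c = "-1" and t = 0]) auto
qed

text \<open>Substituting \<open>R *\<^sub>R \<xi>\<close> for \<xi> gives R^d from the Jacobian,
  R^(-2d) from the squared transform and R^(2s) taken out of the weight, in which 1/R^2 remains
  beside |\<xi>|^2.\<close>

lemma sobolev_integral_dilation:
  fixes f :: "real ^ 'n::finite \<Rightarrow> complex"
  assumes f: "schwartz f" and R: "R > 0"
  shows "sobolev_integral 1 s (\<lambda>x. f (R *\<^sub>R x)) = R powr (2 * s - CARD('n)) * sobolev_integral (1 / R\<^sup>2) s f"
proof -
  let ?d = "CARD('n)"
  have [measurable]: "fourier_transform f \<in> borel_measurable borel"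
    by (rule fourier_transform_measurable[OF f])
  have *: "(1 + (norm (R *\<^sub>R \<xi>))\<^sup>2) powr s * (norm (fourier_transform f ((R *\<^sub>R \<xi>) /\<^sub>R R) /\<^sub>R R ^ ?d))\<^sup>2
      = R powr (2 * s) / R ^ (2 * ?d) * ((1 / R\<^sup>2 + (norm \<xi>)\<^sup>2) powr s * (norm (fourier_transform f \<xi>))\<^sup>2)" for \<xi> :: "real ^ 'n"
  proof -
    have "1 + (norm (R *\<^sub>R \<xi>))\<^sup>2 = R\<^sup>2 * (1 / R\<^sup>2 + (norm \<xi>)\<^sup>2)"
      using R by (simp add: field_simps)
    then have "(1 + (norm (R *\<^sub>R \<xi>))\<^sup>2) powr s = R powr (2 * s) * (1 / R\<^sup>2 + (norm \<xi>)\<^sup>2) powr s"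
      using R by (simp add: powr_mult powr_powr flip: powr_numeral)
    moreover have "(norm (fourier_transform f ((R *\<^sub>R \<xi>) /\<^sub>R R) /\<^sub>R R ^ ?d))\<^sup>2 = (norm (fourier_transform f \<xi>))\<^sup>2 / R ^ (2 * ?d)"
      using R by (simp add: power_mult_distrib divide_inverse power_mult power_inverse mult.commute flip: power_mult)
    ultimately show ?thesis
      by simp
  qed
  have "(LINT \<xi>|lborel. (1 + (norm \<xi>)\<^sup>2) powr s * (norm (fourier_transform (\<lambda>x. f (R *\<^sub>R x)) \<xi>))\<^sup>2)
      = R ^ ?d * (LINT \<xi>|lborel. R powr (2 * s) / R ^ (2 * ?d) * ((1 / R\<^sup>2 + (norm \<xi>)\<^sup>2) powr s * (norm (fourier_transform f (\<xi>::real ^ 'n)))\<^sup>2))"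
    unfolding fourier_transform_dilation[OF f R] *[symmetric]
    using R by (subst integral_lborel_affine[where c = R and t = 0]) auto
  also have "\<dots> = R powr (2 * s - ?d) * (LINT \<xi>|lborel. (1 / R\<^sup>2 + (norm \<xi>)\<^sup>2) powr s * (norm (fourier_transform f \<xi>))\<^sup>2)"
  proof -
    have "R ^ ?d * (R powr (2 * s) / R ^ (2 * ?d)) = R powr (2 * s - ?d)"
    proof -
      have "R powr (2 * s - ?d) = R powr (2 * s) / R ^ ?d"
        using R by (simp add: powr_diff powr_realpow)
      moreover have "R ^ (2 * ?d) = R ^ ?d * R ^ ?d"
        unfolding mult_2 by (rule power_add)
      ultimately show ?thesis
        using R by simp
    qed
    then show ?thesis
      unfolding integral_mult_right_zero mult.assoc[symmetric, of "R ^ ?d"] by (rule arg_cong)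
  qed
  finally show ?thesis
    by (simp add: sobolev_integral_def)
qed

section \<open>The maximal function\<close>

lemma wave_eq_fourier_integral:
  fixes f :: "real ^ 'n::finite \<Rightarrow> complex"
  shows "wave t f x = fourier_integral (\<lambda>\<xi>. iexp (t * norm \<xi>) * fourier_transform f \<xi>) x / (2 * complex_of_real pi) ^ CARD('n)"
  by (simp add: wave_def fourier_integral_def distrib_left exp_add mult.assoc)

lemma isCont_wave:
  assumes "schwartz f"
  shows "isCont (wave t f) x"
proof -
  have "integrable lborel (\<lambda>\<xi>. iexp (t * norm \<xi>) * fourier_transform f \<xi>)"
    using fourier_transform_integrable[OF assms] by (rule integrable_unimodular_mult) auto
  then show ?thesis
    unfolding wave_eq_fourier_integral[abs_def] by (intro continuous_intros isCont_fourier_integral) auto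
qed

lemma isCont_wave_time:
  assumes f: "schwartz f"
  shows "isCont (\<lambda>t. wave t f x) t"
  unfolding continuous_at_sequentially
proof safe
  fix X assume X: "X \<longlonglongrightarrow> t"
  have [measurable]: "fourier_transform f \<in> borel_measurable borel"
    by (rule fourier_transform_measurable[OF f])
  have "(\<lambda>n. fourier_integral (\<lambda>\<xi>. iexp (X n * norm \<xi>) * fourier_transform f \<xi>) x)
      \<longlonglongrightarrow> fourier_integral (\<lambda>\<xi>. iexp (t * norm \<xi>) * fourier_transform f \<xi>) x"
    unfolding fourier_integral_def
  proof (rule integral_dominated_convergence[where w = "\<lambda>\<xi>. norm (fourier_transform f \<xi>)"])
    show "AE \<xi> in lborel. (\<lambda>n. iexp (x \<bullet> \<xi>) * (iexp (X n * norm \<xi>) * fourier_transform f \<xi>))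
        \<longlonglongrightarrow> iexp (x \<bullet> \<xi>) * (iexp (t * norm \<xi>) * fourier_transform f \<xi>)"
      by (intro AE_I2 tendsto_intros X)
  qed (use fourier_transform_integrable[OF f] in \<open>auto simp: norm_mult\<close>)
  then show "((\<lambda>t. wave t f x) \<circ> X) \<longlonglongrightarrow> wave t f x"
    unfolding comp_def wave_eq_fourier_integral by (intro tendsto_intros) auto
qed

text \<open>Conjugation negates the whole phase. The reflection of \<xi> restores the sign of x
  \<bullet> \<xi>, but |\<xi>| is even, so time stays reversed.\<close>

lemma wave_cnj:
  fixes f :: "real ^ 'n::finite \<Rightarrow> complex"
  assumes f: "schwartz f"
  shows "wave t (\<lambda>x. cnj (f x)) x = cnj (wave (- t) f x)"
proof -
  have [measurable]: "fourier_transform f \<in> borel_measurable borel"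
    by (rule fourier_transform_measurable[OF f])
  have meas: "(\<lambda>\<xi>. iexp (x \<bullet> \<xi> + t * norm \<xi>) * cnj (fourier_transform f (- \<xi>))) \<in> borel_measurable borel"
    by measurable
  have "(LINT \<xi>|lborel. iexp (x \<bullet> \<xi> + t * norm \<xi>) * fourier_transform (\<lambda>x. cnj (f x)) \<xi>)
      = (LINT \<xi>|lborel. cnj (iexp (x \<bullet> \<xi> + (- t) * norm \<xi>) * fourier_transform f \<xi>))"
    unfolding fourier_transform_cnj using integral_lborel_affine[OF meas, of "-1" 0]
    by (simp add: exp_cnj algebra_simps)
  then show ?thesis
    unfolding wave_def by (simp only: Bochner_Integration.integral_cnj) simp
qed

text \<open>The symbol |\<xi>| is homogeneous of degree one, so space and time scale by the same
  factor.\<close>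

lemma wave_dilation:
  fixes f :: "real ^ 'n::finite \<Rightarrow> complex"
  assumes f: "schwartz f" and R: "R > 0"
  shows "wave t (\<lambda>x. f (R *\<^sub>R x)) x = wave (R * t) f (R *\<^sub>R x)"
proof -
  have [measurable]: "fourier_transform f \<in> borel_measurable borel"
    by (rule fourier_transform_measurable[OF f])
  have meas: "(\<lambda>\<xi>. iexp (x \<bullet> \<xi> + t * norm \<xi>) * (fourier_transform f (\<xi> /\<^sub>R R) /\<^sub>R R ^ CARD('n))) \<in> borel_measurable borel"
    by measurable
  have *: "iexp (x \<bullet> (0 + R *\<^sub>R \<xi>) + t * norm (0 + R *\<^sub>R \<xi>)) * (fourier_transform f ((0 + R *\<^sub>R \<xi>) /\<^sub>R R) /\<^sub>R R ^ CARD('n))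
      = (iexp ((R *\<^sub>R x) \<bullet> \<xi> + (R * t) * norm \<xi>) * fourier_transform f \<xi>) /\<^sub>R R ^ CARD('n)" for \<xi> :: "real ^ 'n"
    using R by (simp add: mult_ac)
  have "(LINT \<xi>|lborel. iexp (x \<bullet> \<xi> + t * norm \<xi>) * (fourier_transform f (\<xi> /\<^sub>R R) /\<^sub>R R ^ CARD('n)))
      = (LINT \<xi>|lborel. iexp ((R *\<^sub>R x) \<bullet> \<xi> + (R * t) * norm \<xi>) * fourier_transform f \<xi>)"
    using integral_lborel_affine[OF meas, of R 0] R unfolding * by simp
  then show ?thesis
    unfolding wave_def fourier_transform_dilation[OF f R] by simp
qed

text \<open>The q-th power of the maximal function, with the power inside the supremum so that each
  term is real. Its integral can be rescaled, split and passed to monotone limits, and the root is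
  taken at the end.\<close>

definition maximal_power :: "real \<Rightarrow> real set \<Rightarrow> (real ^ 'n::finite \<Rightarrow> complex) \<Rightarrow> real ^ 'n \<Rightarrow> ennreal" where
  "maximal_power q I f x = (SUP t\<in>I. ennreal (norm (wave t f x) powr q))"

lemma ennreal_powr_wave_maximal: "q > 0 \<Longrightarrow> ennreal_powr (wave_maximal I f x) q = maximal_power q I f x"
  by (simp add: wave_maximal_def maximal_power_def ennreal_powr_SUP ennreal_powr_ennreal)

text \<open>The supremum may run over uncountably many times. Each wave is continuous in space, so
  the supremum is lower semicontinuous: its strict superlevel sets are unions of open sets.\<close>

lemma maximal_power_measurable:
  assumes f: "schwartz f" and q: "q > 0"
  shows "maximal_power q I f \<in> borel_measurable borel"
proof (rule borel_measurableI_greater)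
  fix a
  have cont: "continuous_on UNIV (\<lambda>x. ennreal (norm (wave t f x) powr q))" for t
    using q isCont_wave[OF f]
    by (intro continuous_on_ennreal continuous_on_powr' continuous_intros continuous_at_imp_continuous_on) auto
  have "{x \<in> space borel. a < maximal_power q I f x} = (\<Union>t\<in>I. {x. a < ennreal (norm (wave t f x) powr q)})"
    by (auto simp: maximal_power_def less_SUP_iff)
  moreover have "open \<dots>"
    by (intro open_UN ballI open_Collect_less cont continuous_on_const)
  ultimately show "{x \<in> space borel. a < maximal_power q I f x} \<in> sets borel"
    by simp
qed

lemma maximal_power_mono: "I \<subseteq> J \<Longrightarrow> maximal_power q I f x \<le> maximal_power q J f x"
  unfolding maximal_power_def by (rule SUP_subset_mono) auto

lemma maximal_power_dilation:
  assumes "schwartz f" "R > 0"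
  shows "maximal_power q {0<..<1} (\<lambda>x. f (R *\<^sub>R x)) x = maximal_power q {0<..<R} f (R *\<^sub>R x)"
proof -
  have "{0<..<R} = (*) R ` {0<..<1}"
  proof (intro equalityI subsetI)
    fix t assume "t \<in> {0<..<R}"
    then show "t \<in> (*) R ` {0<..<1}"
      using assms(2) by (intro image_eqI[of _ _ "t / R"]) auto
  qed (use assms(2) in auto)
  then show ?thesis
    using assms by (simp add: maximal_power_def wave_dilation image_image)
qed

text \<open>A sum in place of a maximum of the two half-lines, because integrals of sums split; this
  produces the factor 2 in the global bound.\<close>

lemma maximal_power_UNIV_le:
  assumes f: "schwartz f" and q: "q > 0"
  shows "maximal_power q UNIV f x \<le> maximal_power q {0<..} f x + maximal_power q {0<..} (\<lambda>x. cnj (f x)) x"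
  unfolding maximal_power_def[of q UNIV]
proof (rule SUP_least)
  fix t :: real
  have pos: "ennreal (norm (wave t g x) powr q) \<le> maximal_power q {0<..} g x" if "t > 0" for g t
    unfolding maximal_power_def using that by (intro SUP_upper) auto
  consider "t > 0" | "t < 0" | "t = 0" by linarith
  then show "ennreal (norm (wave t f x) powr q) \<le> maximal_power q {0<..} f x + maximal_power q {0<..} (\<lambda>x. cnj (f x)) x"
  proof cases
    case 1
    then show ?thesis
      using pos by (intro add_increasing2) auto
  next
    case 2
    then show ?thesis
      using pos[of "- t" "\<lambda>x. cnj (f x)"] by (intro add_increasing) (auto simp: wave_cnj[OF f])
  next
    case 3
    have "(\<lambda>n. wave (inverse (real (Suc n))) f x) \<longlonglongrightarrow> wave 0 f x"
      by (rule isCont_tendsto_compose[OF isCont_wave_time[OF f] LIMSEQ_inverse_real_of_nat])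
    then have "(\<lambda>n. ennreal (norm (wave (inverse (real (Suc n))) f x) powr q)) \<longlonglongrightarrow> ennreal (norm (wave 0 f x) powr q)"
      using q by (intro tendsto_ennrealI tendsto_powr' tendsto_norm tendsto_const) auto
    then have "ennreal (norm (wave 0 f x) powr q) \<le> maximal_power q {0<..} f x"
      by (rule LIMSEQ_le_const2) (auto intro!: exI[of _ 0] pos)
    then show ?thesis
      using 3 by (intro add_increasing2) auto
  qed
qed

text \<open>The local bound is applied to a dilate of \<open>f\<close>. The ball contributes R^d,
  the q-th power of the Sobolev norm contributes R^(-d), and the constant \<open>C\<close> survives
  unchanged for every \<open>R\<close>.\<close>

lemma maximal_power_dilated_bound:
  fixes f :: "real ^ 'n::finite \<Rightarrow> complex"
  assumes f: "schwartz f" and q: "q > 0" and s: "s = real CARD('n) / 2 - real CARD('n) / q"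
    and C: "0 \<le> C" and R: "R > 0"
    and local: "\<And>f :: real ^ 'n \<Rightarrow> complex. schwartz f \<Longrightarrow>
      (\<integral>\<^sup>+x. maximal_power q {0<..<1} f x * indicator (ball 0 1) x \<partial>lborel) \<le> ennreal ((C * sqrt (sobolev_integral 1 s f)) powr q)"
  shows "(\<integral>\<^sup>+x. maximal_power q {0<..<R} f x * indicator (ball 0 R) x \<partial>lborel)
    \<le> ennreal ((C * sqrt (sobolev_integral (1 / R\<^sup>2) s f)) powr q)"
proof -
  let ?d = "CARD('n)" and ?f = "\<lambda>x. f (R *\<^sub>R x)"
  have [measurable]: "maximal_power q {0<..<R} f \<in> borel_measurable borel"
    by (rule maximal_power_measurable[OF f q])
  have ind: "indicator (ball 0 R) (R *\<^sub>R x) = (indicator (ball 0 1) x :: ennreal)" for x :: "real ^ 'n"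
    using R by (auto simp: indicator_def)
  have "(\<integral>\<^sup>+x. maximal_power q {0<..<R} f x * indicator (ball 0 R) x \<partial>lborel)
      = ennreal (R ^ ?d) * (\<integral>\<^sup>+x. maximal_power q {0<..<1} ?f x * indicator (ball 0 1) x \<partial>lborel)"
    unfolding maximal_power_dilation[OF f R] ind[symmetric]
    using R by (subst nn_integral_lborel_affine[where c = R and t = 0])
      (auto intro!: borel_measurable_times_ennreal borel_measurable_indicator)
  also have "\<dots> \<le> ennreal (R ^ ?d) * ennreal ((C * sqrt (sobolev_integral 1 s ?f)) powr q)"
    by (intro mult_left_mono local schwartz_dilation f R) auto
  also have "\<dots> = ennreal (R ^ ?d * (C * sqrt (sobolev_integral 1 s ?f)) powr q)"
    using R by (simp add: ennreal_mult')
  also have "R ^ ?d * (C * sqrt (sobolev_integral 1 s ?f)) powr q = (C * sqrt (sobolev_integral (1 / R\<^sup>2) s f)) powr q"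
  proof -
    \<comment> \<open>The square root halves the exponent 2s - d, and the choice of \<open>s\<close>
      makes the half equal to -d/q.\<close>
    have "sqrt (sobolev_integral 1 s ?f) = R powr (- ?d / q) * sqrt (sobolev_integral (1 / R\<^sup>2) s f)"
      using R by (simp add: sobolev_integral_dilation[OF f] real_sqrt_mult s powr_half_sqrt[symmetric] powr_powr)
    then have "(C * sqrt (sobolev_integral 1 s ?f)) powr q
        = (R powr (- ?d / q)) powr q * (C * sqrt (sobolev_integral (1 / R\<^sup>2) s f)) powr q"
      using C by (simp add: powr_mult[symmetric] sobolev_integral_nonneg mult_ac)
    also have "(R powr (- ?d / q)) powr q = 1 / R ^ ?d"
    proof -
      have "(R powr (- ?d / q)) powr q = R powr (- real ?d)"
        unfolding powr_powr using q by simp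
      then show ?thesis
        using R by (simp add: powr_minus powr_realpow divide_inverse)
    qed
    finally show ?thesis
      using R by simp
  qed
  finally show ?thesis .
qed

text \<open>The two limits are taken separately. At radius \<open>Suc n\<close> the available bound
  is no smaller than the desired one, so the truncation \<open>F n\<close> is held fixed while it is
  bounded through every larger radius \<open>Suc m\<close>. Letting \<open>m\<close> tend to
  infinity gives the homogeneous norm for each \<open>n\<close>, and monotone convergence in
  \<open>n\<close> removes the truncation.\<close>

lemma maximal_power_half_line_bound:
  fixes f :: "real ^ 'n::finite \<Rightarrow> complex"
  assumes f: "schwartz f" and q: "q > 0" and s: "s = real CARD('n) / 2 - real CARD('n) / q" "s > 0"
    and C: "0 \<le> C"
    and local: "\<And>f :: real ^ 'n \<Rightarrow> complex. schwartz f \<Longrightarrow>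
      (\<integral>\<^sup>+x. maximal_power q {0<..<1} f x * indicator (ball 0 1) x \<partial>lborel) \<le> ennreal ((C * sqrt (sobolev_integral 1 s f)) powr q)"
  shows "(\<integral>\<^sup>+x. maximal_power q {0<..} f x \<partial>lborel) \<le> ennreal ((C * sqrt (sobolev_integral 0 s f)) powr q)"
proof -
  define F where "F n x = maximal_power q {0<..<real (Suc n)} f x * indicator (ball 0 (real (Suc n))) x" for n x
  have [measurable]: "F n \<in> borel_measurable borel" for n
    unfolding F_def[abs_def]
    by (intro borel_measurable_times_ennreal borel_measurable_indicator maximal_power_measurable f q) auto
  have incF: "incseq F"
    unfolding F_def
    by (intro incseq_SucI le_funI mult_mono maximal_power_mono) (auto simp: indicator_def)
  have le: "(\<integral>\<^sup>+x. F n x \<partial>lborel) \<le> ennreal ((C * sqrt (sobolev_integral 0 s f)) powr q)" for n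
  proof (rule LIMSEQ_le_const)
    have "(\<lambda>m. (C * sqrt (sobolev_integral (1 / (real (Suc m))\<^sup>2) s f)) powr q) \<longlonglongrightarrow> (C * sqrt (sobolev_integral 0 s f)) powr q"
      using q C by (intro tendsto_powr' tendsto_intros sobolev_integral_limit[OF f s(2)])
        (auto simp: sobolev_integral_nonneg)
    then show "(\<lambda>m. ennreal ((C * sqrt (sobolev_integral (1 / (real (Suc m))\<^sup>2) s f)) powr q))
        \<longlonglongrightarrow> ennreal ((C * sqrt (sobolev_integral 0 s f)) powr q)"
      by (rule tendsto_ennrealI)
    have "(\<integral>\<^sup>+x. F n x \<partial>lborel) \<le> ennreal ((C * sqrt (sobolev_integral (1 / (real (Suc m))\<^sup>2) s f)) powr q)" if "m \<ge> n" for m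
    proof -
      have "(\<integral>\<^sup>+x. F n x \<partial>lborel) \<le> (\<integral>\<^sup>+x. F m x \<partial>lborel)"
        using incseqD[OF incF that] by (intro nn_integral_mono) (simp add: le_fun_def)
      also have "\<dots> \<le> ennreal ((C * sqrt (sobolev_integral (1 / (real (Suc m))\<^sup>2) s f)) powr q)"
        unfolding F_def by (rule maximal_power_dilated_bound[OF f q s(1) C _ local]) auto
      finally show ?thesis .
    qed
    then show "\<exists>N. \<forall>m\<ge>N. (\<integral>\<^sup>+x. F n x \<partial>lborel) \<le> ennreal ((C * sqrt (sobolev_integral (1 / (real (Suc m))\<^sup>2) s f)) powr q)"
      by blast
  qed
  have "maximal_power q {0<..} f x \<le> (SUP n. F n x)" for x
    unfolding maximal_power_def
  proof (rule SUP_least)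
    fix t :: real assume t: "t \<in> {0<..}"
    \<comment> \<open>An index above both \<open>t\<close> and \<open>norm x\<close> puts the time
      into the interval and the point into the ball of \<open>F n\<close>.\<close>
    obtain n where n: "max t (norm x) < real n"
      using reals_Archimedean2 by blast
    have "ennreal (norm (wave t f x) powr q) \<le> F n x"
      using n t by (auto simp: F_def maximal_power_def intro!: SUP_upper)
    also have "\<dots> \<le> (SUP n. F n x)"
      by (rule SUP_upper) simp
    finally show "ennreal (norm (wave t f x) powr q) \<le> (SUP n. F n x)" .
  qed
  then have "(\<integral>\<^sup>+x. maximal_power q {0<..} f x \<partial>lborel) \<le> (\<integral>\<^sup>+x. (SUP n. F n x) \<partial>lborel)"
    by (intro nn_integral_mono) auto
  also have "\<dots> = (SUP n. \<integral>\<^sup>+x. F n x \<partial>lborel)"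
    using incF by (intro nn_integral_monotone_convergence_SUP) auto
  also have "\<dots> \<le> ennreal ((C * sqrt (sobolev_integral 0 s f)) powr q)"
    by (intro SUP_least le)
  finally show ?thesis .
qed

lemma global_of_local:
  fixes f :: "real ^ 'n::finite \<Rightarrow> complex"
  assumes f: "schwartz f" and q: "q > 0" and s: "s = real CARD('n) / 2 - real CARD('n) / q" "s > 0"
    and C: "0 \<le> C"
    and local: "\<And>f :: real ^ 'n \<Rightarrow> complex. schwartz f \<Longrightarrow>
      Lp_norm q (restrict_space lborel (ball 0 1)) (wave_maximal {0<..<1} f) \<le> ennreal C * sobolev_norm s f"
  shows "Lp_norm q lborel (wave_maximal UNIV f) \<le> ennreal (2 powr (1 / q) * C) * hom_sobolev_norm s f"
proof -
  have "(\<integral>\<^sup>+x. maximal_power q {0<..<1} g x * indicator (ball 0 1) x \<partial>lborel) \<le> ennreal ((C * sqrt (sobolev_integral 1 s g)) powr q)"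
    if g: "schwartz g" for g :: "real ^ 'n \<Rightarrow> complex"
  proof -
    have "Lp_norm q (restrict_space lborel (ball 0 1)) (wave_maximal {0<..<1} g) \<le> ennreal (C * sqrt (sobolev_integral 1 s g))"
      using local[OF g] C by (simp add: sobolev_norm_eq[OF g s(2)] ennreal_mult' sobolev_integral_nonneg)
    then show ?thesis
      using q C by (subst (asm) Lp_norm_le_iff)
        (simp_all add: sobolev_integral_nonneg ennreal_powr_wave_maximal nn_integral_restrict_space)
  qed
  note half = maximal_power_half_line_bound[OF _ q s C this]
  let ?K = "C * sqrt (sobolev_integral 0 s f)"
  have [measurable]: "maximal_power q {0<..} f \<in> borel_measurable borel" "maximal_power q {0<..} (\<lambda>x. cnj (f x)) \<in> borel_measurable borel"
    using f q by (auto intro: maximal_power_measurable schwartz_cnj)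
  have "(\<integral>\<^sup>+x. maximal_power q UNIV f x \<partial>lborel)
      \<le> (\<integral>\<^sup>+x. maximal_power q {0<..} f x + maximal_power q {0<..} (\<lambda>x. cnj (f x)) x \<partial>lborel)"
    by (intro nn_integral_mono maximal_power_UNIV_le f q)
  also have "\<dots> = (\<integral>\<^sup>+x. maximal_power q {0<..} f x \<partial>lborel) + (\<integral>\<^sup>+x. maximal_power q {0<..} (\<lambda>x. cnj (f x)) x \<partial>lborel)"
    by (intro nn_integral_add) auto
  also have "\<dots> \<le> ennreal (?K powr q) + ennreal (?K powr q)"
    using half[OF f] half[OF schwartz_cnj[OF f]] by (intro add_mono) (simp_all add: sobolev_integral_cnj[OF f])
  \<comment> \<open>Two equal q-th powers, one for each direction of time, merge into one: the
    factor 2 becomes 2^(1/q) inside.\<close>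
  also have "\<dots> = ennreal ((2 powr (1 / q) * ?K) powr q)"
    using q C by (simp add: powr_mult powr_powr sobolev_integral_nonneg flip: ennreal_plus)
  finally have "Lp_norm q lborel (wave_maximal UNIV f) \<le> ennreal (2 powr (1 / q) * ?K)"
    using q C by (simp add: Lp_norm_le_iff sobolev_integral_nonneg ennreal_powr_wave_maximal)
  then show ?thesis
    using C by (simp add: hom_sobolev_norm_eq[OF f s(2)] ennreal_mult'[symmetric] sobolev_integral_nonneg mult.assoc)
qed

lemma local_of_global:
  fixes f :: "real ^ 'n::finite \<Rightarrow> complex"
  assumes f: "schwartz f" and q: "q > 0" and s: "s > 0"
    and global: "Lp_norm q lborel (wave_maximal UNIV f) \<le> ennreal C * hom_sobolev_norm s f"
  shows "Lp_norm q (restrict_space lborel (ball 0 1)) (wave_maximal {0<..<1} f) \<le> ennreal C * sobolev_norm s f"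
proof -
  have "Lp_norm q (restrict_space lborel (ball 0 1)) (wave_maximal {0<..<1} f) \<le> Lp_norm q lborel (wave_maximal UNIV f)"
    unfolding Lp_norm_def ennreal_powr_wave_maximal[OF q]
    using q by (intro ennreal_powr_mono)
      (auto simp: nn_integral_restrict_space intro!: nn_integral_mono maximal_power_mono split: split_indicator)
  also have "\<dots> \<le> ennreal C * hom_sobolev_norm s f"
    by (rule global)
  also have "\<dots> \<le> ennreal C * sobolev_norm s f"
    using sobolev_integral_mono[OF f s]
    by (intro mult_left_mono) (simp_all add: sobolev_norm_eq[OF f s] hom_sobolev_norm_eq[OF f s] ennreal_leI)
  finally show ?thesis .
qed

theorem proposition1p6:
  fixes q s :: real
  assumes "CARD('n::finite) \<ge> 2"
    and "q \<ge> q_circ (CARD('n))"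
    and "s = real (CARD('n)) / 2 - real (CARD('n)) / q"
  shows "(\<exists>C::real. \<forall>f :: real ^ 'n \<Rightarrow> complex. schwartz f \<longrightarrow>
            Lp_norm q (restrict_space lborel (ball 0 1)) (wave_maximal {0<..<1} f)
              \<le> ennreal C * sobolev_norm s f)
     \<longleftrightarrow> (\<exists>C::real. \<forall>f :: real ^ 'n \<Rightarrow> complex. schwartz f \<longrightarrow>
            Lp_norm q lborel (wave_maximal UNIV f) \<le> ennreal C * hom_sobolev_norm s f)"
proof -
  \<comment> \<open>The critical exponent equals 2 + 4/(d - 1).\<close>
  have "2 < q_circ CARD('n)"
    using assms(1) by (simp add: q_circ_def field_simps)
  then have q: "2 < q"
    using assms(2) by simp
  then have "1 / q < 1 / 2"
    by (simp add: field_simps)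
  moreover have "s = real CARD('n) * (1 / 2 - 1 / q)"
    using assms(3) by (simp add: algebra_simps)
  ultimately have s: "s > 0"
    using assms(1) by simp
  show ?thesis
  proof
    assume "\<exists>C::real. \<forall>f :: real ^ 'n \<Rightarrow> complex. schwartz f \<longrightarrow>
      Lp_norm q (restrict_space lborel (ball 0 1)) (wave_maximal {0<..<1} f) \<le> ennreal C * sobolev_norm s f"
    then obtain C where C: "\<And>f :: real ^ 'n \<Rightarrow> complex. schwartz f \<Longrightarrow>
      Lp_norm q (restrict_space lborel (ball 0 1)) (wave_maximal {0<..<1} f) \<le> ennreal C * sobolev_norm s f"
      by blast
    \<comment> \<open>A negative constant is read as 0 by \<open>ennreal\<close>, so the
      nonnegativity that \<open>global_of_local\<close> asks for costs nothing.\<close>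
    have "ennreal C = ennreal (max 0 C)"
      by (simp add: max_def ennreal_neg)
    note local = C[unfolded this]
    show "\<exists>C::real. \<forall>f :: real ^ 'n \<Rightarrow> complex. schwartz f \<longrightarrow>
      Lp_norm q lborel (wave_maximal UNIV f) \<le> ennreal C * hom_sobolev_norm s f"
    proof (intro exI allI impI)
      fix f :: "real ^ 'n \<Rightarrow> complex" assume f: "schwartz f"
      show "Lp_norm q lborel (wave_maximal UNIV f) \<le> ennreal (2 powr (1 / q) * max 0 C) * hom_sobolev_norm s f"
        using q by (intro global_of_local[OF f _ assms(3) s _ local]) auto
    qed
  next
    assume "\<exists>C::real. \<forall>f :: real ^ 'n \<Rightarrow> complex. schwartz f \<longrightarrow>
      Lp_norm q lborel (wave_maximal UNIV f) \<le> ennreal C * hom_sobolev_norm s f"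
    then obtain C where C: "\<And>f :: real ^ 'n \<Rightarrow> complex. schwartz f \<Longrightarrow>
      Lp_norm q lborel (wave_maximal UNIV f) \<le> ennreal C * hom_sobolev_norm s f"
      by blast
    show "\<exists>C::real. \<forall>f :: real ^ 'n \<Rightarrow> complex. schwartz f \<longrightarrow>
      Lp_norm q (restrict_space lborel (ball 0 1)) (wave_maximal {0<..<1} f) \<le> ennreal C * sobolev_norm s f"
      using q by (intro exI[of _ C] allI impI local_of_global s C) auto
  qed
qed

end
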